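(* Let $F$ be a finite field of characteristic $3$ containing $q=3^k$ elements, let $n\ge 1$ be an integer, and let $G=C_n\times Q_{12}$. Then $$U(FG)\cong (C_3^{6nk}\rtimes C_3^{2nk})\rtimes U\big(F(C_n\times C_4)\big).$$
   Context: $C_m$ denotes the cyclic group of order $m$, and $C_m^j$ the direct product of $j$ copies of $C_m$. $Q_{12}$ is the quaternion (dicyclic) group of order 12, $Q_{12}=\langle x,y\mid x^3=y^4=1,\ xy=yx^2\rangle$. For a finite group $H$, $FH$ is the group algebra of $H$ over $F$ and $U(FH)$ is its group of units. The symbol $A\rtimes B$ denotes a semidirect product with normal factor $A$ for some action of $B$ on $A$. *)

theory Defs
  imports "HOL-Algebra.Algebra"
begin

section \<open>Cyclic groups and their powers\<close>

abbreviation cyclic_gp :: "nat \<Rightarrow> int monoid" where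
  "cyclic_gp m \<equiv> integer_mod_group m"

definition cyclic_power :: "nat \<Rightarrow> nat \<Rightarrow> (nat \<Rightarrow> int) monoid" where
  "cyclic_power m j = product_group {..<j} (\<lambda>_. cyclic_gp m)"


section \<open>Groups given by generators and relations\<close>

text \<open>A word is a list of letters; the letter \<open>(g, True)\<close> stands for the generator \<open>g\<close> and
  \<open>(g, False)\<close> for its formal inverse. The generators are all elements of the type \<open>'g\<close>. A pair
  \<open>(u, v)\<close> in \<open>R\<close> is the defining relation \<open>u = v\<close>.\<close>

type_synonym 'g word = "('g \<times> bool) list"

inductive word_eq :: "('g word \<times> 'g word) set \<Rightarrow> 'g word \<Rightarrow> 'g word \<Rightarrow> bool"
  for R :: "('g word \<times> 'g word) set" where
  refl: "word_eq R u u"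
| sym: "word_eq R u v \<Longrightarrow> word_eq R v u"
| trans: "word_eq R u v \<Longrightarrow> word_eq R v w \<Longrightarrow> word_eq R u w"
| append: "word_eq R u u' \<Longrightarrow> word_eq R v v' \<Longrightarrow> word_eq R (u @ v) (u' @ v')"
| cancel: "word_eq R [(g, b), (g, \<not> b)] []"
| relation: "(u, v) \<in> R \<Longrightarrow> word_eq R u v"

definition word_class :: "('g word \<times> 'g word) set \<Rightarrow> 'g word \<Rightarrow> 'g word set" where
  "word_class R u = {v. word_eq R u v}"

definition presented_group :: "('g word \<times> 'g word) set \<Rightarrow> 'g word set monoid" where
  "presented_group R =
    \<lparr>carrier = range (word_class R),
     monoid.mult = (\<lambda>A B. {w. \<exists>a\<in>A. \<exists>b\<in>B. word_eq R (a @ b) w}),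
     one = word_class R []\<rparr>"

lemma word_class_eq_iff: "word_class R u = word_class R v \<longleftrightarrow> word_eq R u v"
  unfolding word_class_def by (blast intro: word_eq.intros)

lemma carrier_presented_group [simp]:
  "carrier (presented_group R) = range (word_class R)"
  by (simp add: presented_group_def)

lemma one_presented_group [simp]: "\<one>\<^bsub>presented_group R\<^esub> = word_class R []"
  by (simp add: presented_group_def)

lemma mult_word_class [simp]:
  "word_class R u \<otimes>\<^bsub>presented_group R\<^esub> word_class R v = word_class R (u @ v)"
  unfolding presented_group_def word_class_def
  by (auto intro: word_eq.refl word_eq.trans word_eq.append)

lemma word_eq_inverse:
  "word_eq R (rev (map (\<lambda>(g, b). (g, \<not> b)) u) @ u) []"
proof (induction u)
  case Nil
  then show ?case by (simp add: word_eq.refl)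
next
  case (Cons l u)
  obtain g b where l: "l = (g, b)" by (cases l)
  let ?i = "rev (map (\<lambda>(g, b). (g, \<not> b)) u)"
  have "word_eq R ([(g, \<not> b), (g, b)] @ u) ([] @ u)"
    using word_eq.cancel[of R g "\<not> b"] by (intro word_eq.append word_eq.refl) simp
  then have "word_eq R (?i @ ([(g, \<not> b), (g, b)] @ u)) (?i @ u)"
    by (intro word_eq.append word_eq.refl) simp
  then show ?case using Cons l by (auto intro: word_eq.trans)
qed

lemma group_presented_group: "group (presented_group R)"
proof (rule groupI)
  fix A assume "A \<in> carrier (presented_group R)"
  then obtain u where "A = word_class R u" by auto
  then show "\<exists>B\<in>carrier (presented_group R). B \<otimes>\<^bsub>presented_group R\<^esub> A = \<one>\<^bsub>presented_group R\<^esub>"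
    by (auto simp: word_class_eq_iff intro!: word_eq_inverse)
qed auto


section \<open>The dicyclic group \<open>Q12\<close>\<close>

datatype q12_gen = Gen_x | Gen_y

text \<open>The relations \<open>x\<^sup>3 = 1\<close>, \<open>y\<^sup>4 = 1\<close> and \<open>x y = y x\<^sup>2\<close>.\<close>

definition Q12_relations :: "(q12_gen word \<times> q12_gen word) set" where
  "Q12_relations =
    (let x = (Gen_x, True); y = (Gen_y, True) in
      {([x, x, x], []), ([y, y, y, y], []), ([x, y], [y, x, x])})"

definition Q12 :: "q12_gen word set monoid" where
  "Q12 = presented_group Q12_relations"


section \<open>Group algebras\<close>

text \<open>For a finite group \<open>G\<close>, the element \<open>\<Sum>g\<in>G. f(g) g\<close> of the group algebra is represented by
  its coefficient function \<open>f\<close>, made extensional outside \<open>G\<close>. For infinite \<open>G\<close> one would have to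
  restrict to finitely supported functions.\<close>

definition group_algebra ::
    "('a, 'm) ring_scheme \<Rightarrow> ('g, 'n) monoid_scheme \<Rightarrow> ('g \<Rightarrow> 'a) ring" where
  "group_algebra F G =
    \<lparr>carrier = carrier G \<rightarrow>\<^sub>E carrier F,
     monoid.mult = (\<lambda>f h. \<lambda>z\<in>carrier G.
       \<Oplus>\<^bsub>F\<^esub>g\<in>carrier G. f g \<otimes>\<^bsub>F\<^esub> h (inv\<^bsub>G\<^esub> g \<otimes>\<^bsub>G\<^esub> z)),
     one = (\<lambda>z\<in>carrier G. if z = \<one>\<^bsub>G\<^esub> then \<one>\<^bsub>F\<^esub> else \<zero>\<^bsub>F\<^esub>),
     ring.zero = (\<lambda>z\<in>carrier G. \<zero>\<^bsub>F\<^esub>),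
     ring.add = (\<lambda>f h. \<lambda>z\<in>carrier G. f z \<oplus>\<^bsub>F\<^esub> h z)\<rparr>"

definition ring_characteristic :: "('a, 'm) ring_scheme \<Rightarrow> nat" where
  "ring_characteristic R = group.ord (add_monoid R) \<one>\<^bsub>R\<^esub>"


section \<open>Semidirect products\<close>

definition semidirect_product ::
    "('a, 'm) monoid_scheme \<Rightarrow> ('b, 'n) monoid_scheme \<Rightarrow> ('b \<Rightarrow> 'a \<Rightarrow> 'a) \<Rightarrow> ('a \<times> 'b) monoid" where
  "semidirect_product A B \<phi> =
    \<lparr>carrier = carrier A \<times> carrier B,
     monoid.mult = (\<lambda>(a, b) (a', b'). (a \<otimes>\<^bsub>A\<^esub> \<phi> b a', b \<otimes>\<^bsub>B\<^esub> b')),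
     one = (\<one>\<^bsub>A\<^esub>, \<one>\<^bsub>B\<^esub>)\<rparr>"

abbreviation is_action ::
    "('b, 'n) monoid_scheme \<Rightarrow> ('a, 'm) monoid_scheme \<Rightarrow> ('b \<Rightarrow> 'a \<Rightarrow> 'a) \<Rightarrow> bool" where
  "is_action B A \<phi> \<equiv> \<phi> \<in> hom B (AutoGroup A)"

end

theory Submission
  imports Defs
begin

text \<open>Write \<open>H = C\<^sub>n \<times> C\<^sub>4\<close> and \<open>B = FH\<close>. Mapping \<open>x\<close> to \<open>1\<close> and \<open>y\<close> to a generator of \<open>C\<^sub>4\<close> gives
  a split surjection \<open>FG \<rightarrow> B\<close>. Put \<open>t = x - x\<^sup>2\<close>. In characteristic 3 one has
  \<open>t\<^sup>2 = 1 + x + x\<^sup>2\<close>, \<open>t\<^sup>3 = 0\<close>, every element of \<open>FG\<close> is uniquely \<open>a + t b + t\<^sup>2 c\<close> with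
  \<open>a, b, c \<in> B\<close>, and \<open>b t = t \<tau>(b)\<close> for the involution \<open>\<tau>\<close> of \<open>B\<close> that negates the generator of
  \<open>C\<^sub>4\<close>. Hence the kernel of \<open>U(FG) \<rightarrow> U(B)\<close> is the set of all \<open>1 + t b + t\<^sup>2 c\<close>, where the pairs
  \<open>(b, c)\<close> multiply by \<open>(b, c)(b', c') = (b + b', c + c' + \<tau>(b) b')\<close>. The pairs with \<open>\<tau>(b) = b\<close>
  form an elementary abelian normal subgroup of rank \<open>6nk\<close>. Since \<open>-1/2 = 1\<close> in characteristic 3,
  the pairs \<open>(b, b\<^sup>2)\<close> with \<open>\<tau>(b) = -b\<close> form an elementary abelian complement of rank \<open>2nk\<close>.\<close>

section \<open>Recognising elementary abelian p-groups by order and exponent\<close>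

section \<open>Elementary abelian groups\<close>

lemma carrier_cyclic_power:
  "p > 0 \<Longrightarrow> carrier (cyclic_power p j) = {..<j} \<rightarrow>\<^sub>E {0..<int p}"
  by (simp add: cyclic_power_def carrier_integer_mod_group)

lemma mult_cyclic_power:
  "e \<otimes>\<^bsub>cyclic_power p j\<^esub> e' = (\<lambda>i\<in>{..<j}. (e i + e' i) mod int p)"
  by (simp add: cyclic_power_def)

lemma one_cyclic_power: "\<one>\<^bsub>cyclic_power p j\<^esub> = (\<lambda>i\<in>{..<j}. 0)"
  by (simp add: cyclic_power_def)

lemma group_cyclic_power [simp]: "group (cyclic_power p j)"
  unfolding cyclic_power_def by (rule product_group) simp

lemma card_cyclic_power: "p > 0 \<Longrightarrow> card (carrier (cyclic_power p j)) = p ^ j"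
  by (simp add: carrier_cyclic_power card_PiE)

lemma finite_cyclic_power: "p > 0 \<Longrightarrow> finite (carrier (cyclic_power p j))"
  by (simp add: carrier_cyclic_power finite_PiE)

text \<open>Coordinates in a cyclic group of order p are stored as residues; this lets an element
  killed by p be raised to such a coordinate without regard to the reduction.\<close>

lemma (in group) int_pow_mod_exponent:
  assumes "g \<in> carrier G" "g [^] p = \<one>"
  shows "g [^] (z mod int p) = g [^] z"
proof -
  have "g [^] z = g [^] (int p * (z div int p)) \<otimes> g [^] (z mod int p)"
    using assms(1) by (simp flip: int_pow_mult)
  also have "g [^] (int p * (z div int p)) = (g [^] int p) [^] (z div int p)"
    using assms(1) int_pow_pow by simp
  finally show ?thesis
    using assms by (simp add: int_pow_int)
qed

text \<open>The analogue of extending a basis by one vector: the new coordinate becomes the exponent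
  of \<open>g\<close>. Injectivity survives because a nonzero exponent is invertible modulo the
  prime p, so a nontrivial power of \<open>g\<close> in the old image would put \<open>g\<close>
  itself there.\<close>

lemma (in comm_group) cyclic_power_embedding_Suc:
  assumes p: "Factorial_Ring.prime p" and h: "h \<in> hom (cyclic_power p j) G"
    and inj: "inj_on h (carrier (cyclic_power p j))"
    and g: "g \<in> carrier G" "g [^] p = \<one>" "g \<notin> h ` carrier (cyclic_power p j)"
  shows "\<exists>h'\<in>hom (cyclic_power p (Suc j)) G. inj_on h' (carrier (cyclic_power p (Suc j)))"
proof -
  let ?C = "cyclic_power p j" and ?D = "cyclic_power p (Suc j)"
  have p0: "p > 0" using p by (simp add: prime_gt_0_nat)
  interpret h: group_hom ?C G h
    using h by (simp add: group_hom_def group_hom_axioms_def is_group)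
  interpret im: subgroup "h ` carrier ?C" G
    by (rule h.img_is_subgroup)
  have res: "restrict e {..<j} \<in> carrier ?C" if "e \<in> carrier ?D" for e
    using that p0 by (auto simp: carrier_cyclic_power PiE_iff)
  define h' where "h' e = h (restrict e {..<j}) \<otimes> g [^] (e j)" for e
  have hom: "h' \<in> hom ?D G"
  proof (rule homI)
    fix e assume e: "e \<in> carrier ?D"
    then show "h' e \<in> carrier G"
      using res g(1) by (simp add: h'_def)
    fix e' assume e': "e' \<in> carrier ?D"
    have "restrict (e \<otimes>\<^bsub>?D\<^esub> e') {..<j} = restrict e {..<j} \<otimes>\<^bsub>?C\<^esub> restrict e' {..<j}"
      by (auto simp: mult_cyclic_power)
    moreover have "g [^] ((e \<otimes>\<^bsub>?D\<^esub> e') j) = g [^] e j \<otimes> g [^] e' j"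
      using g by (simp add: mult_cyclic_power int_pow_mod_exponent int_pow_mult)
    ultimately show "h' (e \<otimes>\<^bsub>?D\<^esub> e') = h' e \<otimes> h' e'"
      unfolding h'_def using res[OF e] res[OF e'] g(1) by (simp add: m_ac)
  qed
  interpret h': group_hom ?D G h'
    using hom by (simp add: group_hom_def group_hom_axioms_def is_group)
  have "inj_on h' (carrier ?D)"
  proof (subst h'.inj_on_one_iff, intro allI impI)
    fix e assume e: "e \<in> carrier ?D" and one: "h' e = \<one>"
    \<comment> \<open>An element of the kernel forces a power of \<open>g\<close> into the old
      image; once that power is shown to have exponent 0, injectivity of \<open>h\<close> handles
      the other coordinates.\<close>
    have "g [^] e j = inv (h (restrict e {..<j}))"
      using one res[OF e] g(1) unfolding h'_def
      by (metis h.hom_closed int_pow_closed inv_equality m_comm)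
    then have mem: "g [^] e j \<in> h ` carrier ?C"
      using res[OF e] by auto
    have ej: "e j = 0"
    proof (rule ccontr)
      assume "e j \<noteq> 0"
      moreover have "0 \<le> e j" "e j < int p"
        using e p0 by (auto simp: carrier_cyclic_power PiE_iff)
      ultimately have "coprime (e j) (int p)"
        using p by (metis coprime_commute linorder_not_le nat_less_le order.strict_iff_order
            prime_imp_coprime prime_int_nat_transfer prime_nat_int_transfer zdvd_imp_le)
      then obtain u v where "u * e j + v * int p = 1"
        by (metis bezout_int coprime_imp_gcd_eq_1)
      \<comment> \<open>Modulo p the Bezout identity says that \<open>u\<close> inverts
        \<open>e j\<close>, so the \<open>u\<close>-th power of \<open>g [^] e j\<close> is
        \<open>g\<close>.\<close>
      then have "1 mod int p = (e j * u) mod int p"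
        by (metis mod_mult_self1 mult.commute)
      then have "g [^] (1::int) = g [^] (e j * u)"
        by (metis g(1,2) int_pow_mod_exponent)
      then have "g = (g [^] e j) [^] u"
        using g(1) int_pow_pow by simp
      then show False
        using g(3) mem by (metis im.subgroup_axioms subgroup_int_pow_closed)
    qed
    with one have "h (restrict e {..<j}) = \<one>"
      using res[OF e] by (simp add: h'_def)
    then have "restrict e {..<j} = (\<lambda>i\<in>{..<j}. 0)"
      using inj res[OF e] h.inj_on_one_iff by (simp add: one_cyclic_power)
    then have "e i = 0" if "i < j" for i
      using that by (metis lessThan_iff restrict_apply')
    with ej show "e = \<one>\<^bsub>?D\<^esub>"
      using e p0 by (auto simp: one_cyclic_power carrier_cyclic_power PiE_iff extensional_def
          less_Suc_eq)
  qed
  with hom show ?thesis by blast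
qed

text \<open>While j < m the embedded image has only p^j < p^m elements, so some \<open>g\<close>
  outside it can serve as the next coordinate. At j = m the cardinalities agree and the embedding is
  onto.\<close>

lemma (in comm_group) iso_cyclic_power:
  assumes p: "Factorial_Ring.prime p" and fin: "finite (carrier G)"
    and card: "card (carrier G) = p ^ m"
    and exp: "\<And>g. g \<in> carrier G \<Longrightarrow> g [^] p = \<one>"
  shows "cyclic_power p m \<cong> G"
proof -
  have p0: "p > 0" and p1: "p > 1"
    using p by (simp_all add: prime_gt_0_nat prime_gt_Suc_0_nat)
  have "\<exists>h\<in>hom (cyclic_power p j) G. inj_on h (carrier (cyclic_power p j))" if "j \<le> m" for j
    using that
  proof (induction j)
    case 0
    have "(\<lambda>_. \<one>) \<in> hom (cyclic_power p 0) G"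
      by (rule homI) auto
    moreover have "inj_on (\<lambda>_. \<one>) (carrier (cyclic_power p 0))"
      using p0 by (auto simp: carrier_cyclic_power inj_on_def)
    ultimately show ?case by blast
  next
    case (Suc j)
    then obtain h where h: "h \<in> hom (cyclic_power p j) G"
        "inj_on h (carrier (cyclic_power p j))" by auto
    have "card (h ` carrier (cyclic_power p j)) = p ^ j"
      using h(2) p0 by (simp add: card_image card_cyclic_power)
    also have "\<dots> < card (carrier G)"
      using Suc.prems p1 card by (simp add: power_strict_increasing)
    finally have "\<not> carrier G \<subseteq> h ` carrier (cyclic_power p j)"
      using finite_cyclic_power[OF p0] card_mono by (metis finite_imageI leD)
    then obtain g where "g \<in> carrier G" "g \<notin> h ` carrier (cyclic_power p j)" by blast
    with cyclic_power_embedding_Suc[OF p h] exp show ?case by blast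
  qed
  then obtain h where h: "h \<in> hom (cyclic_power p m) G"
      "inj_on h (carrier (cyclic_power p m))" by blast
  have "h ` carrier (cyclic_power p m) = carrier G"
    using h fin p0 by (intro card_subset_eq) (auto simp: hom_def card_image card_cyclic_power card)
  then have "h \<in> iso (cyclic_power p m) G"
    using h by (simp add: iso_def bij_betw_def)
  then show ?thesis by (auto simp: is_iso_def)
qed

section \<open>Semidirect products and split exact sequences\<close>

section \<open>Split extensions\<close>

text \<open>Automorphisms are extensional functions in \<open>AutoGroup\<close>, so its product is
  composition restricted to the carrier, not plain composition.\<close>

lemma is_action_iff:
  "is_action B A \<phi> \<longleftrightarrow>
    (\<forall>b\<in>carrier B. \<phi> b \<in> auto A) \<and>
    (\<forall>b\<in>carrier B. \<forall>b'\<in>carrier B. \<phi> (b \<otimes>\<^bsub>B\<^esub> b') = compose (carrier A) (\<phi> b) (\<phi> b'))"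
  by (auto simp: hom_def AutoGroup_def BijGroup_def auto_def Pi_iff)

lemma group_semidirect_product:
  assumes "group A" "group B" and act: "is_action B A \<phi>"
  shows "group (semidirect_product A B \<phi>)"
proof -
  interpret A: group A by fact
  interpret B: group B by fact
  interpret \<phi>: group_hom B "AutoGroup A" \<phi>
    using act A.AutoGroup by (simp add: group_hom_def group_hom_axioms_def B.is_group)
  note \<phi>.hom_inv [simp del] \<phi>.hom_mult [simp del] \<phi>.hom_one [simp del]
  have auto: "\<phi> b \<in> auto A" if "b \<in> carrier B" for b
    using that act by (simp add: is_action_iff)
  have closed: "\<phi> b a \<in> carrier A" if "b \<in> carrier B" "a \<in> carrier A" for a b
    using auto[OF that(1)] that(2) by (auto simp: auto_def hom_def)
  have mult: "\<phi> b (a \<otimes>\<^bsub>A\<^esub> a') = \<phi> b a \<otimes>\<^bsub>A\<^esub> \<phi> b a'"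
    if "b \<in> carrier B" "a \<in> carrier A" "a' \<in> carrier A" for a a' b
    using auto[OF that(1)] that(2,3) by (auto simp: auto_def hom_def)
  have comp: "\<phi> (b \<otimes>\<^bsub>B\<^esub> b') a = \<phi> b (\<phi> b' a)"
    if "b \<in> carrier B" "b' \<in> carrier B" "a \<in> carrier A" for a b b'
    using act that unfolding is_action_iff by (simp add: compose_eq)
  have one: "\<phi> \<one>\<^bsub>B\<^esub> a = a" if "a \<in> carrier A" for a
    using \<phi>.hom_one that by (simp add: AutoGroup_def BijGroup_def)
  \<comment> \<open>The image of the identity is idempotent, hence the identity.\<close>
  have fix_one: "\<phi> b \<one>\<^bsub>A\<^esub> = \<one>\<^bsub>A\<^esub>" if "b \<in> carrier B" for b
    using mult[OF that A.one_closed A.one_closed] closed[OF that A.one_closed]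
    by (metis A.l_one A.one_closed A.r_cancel_one')
  show ?thesis
  proof (rule groupI)
    fix z assume "z \<in> carrier (semidirect_product A B \<phi>)"
    then obtain a b where z: "z = (a, b)" "a \<in> carrier A" "b \<in> carrier B"
      by (auto simp: semidirect_product_def)
    have "(\<phi> (inv\<^bsub>B\<^esub> b) (inv\<^bsub>A\<^esub> a), inv\<^bsub>B\<^esub> b) \<otimes>\<^bsub>semidirect_product A B \<phi>\<^esub> z
        = \<one>\<^bsub>semidirect_product A B \<phi>\<^esub>"
      using z by (simp add: semidirect_product_def fix_one flip: mult)
    then show "\<exists>y\<in>carrier (semidirect_product A B \<phi>).
        y \<otimes>\<^bsub>semidirect_product A B \<phi>\<^esub> z = \<one>\<^bsub>semidirect_product A B \<phi>\<^esub>"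
      using z by (intro bexI[of _ "(\<phi> (inv\<^bsub>B\<^esub> b) (inv\<^bsub>A\<^esub> a), inv\<^bsub>B\<^esub> b)"])
        (auto simp: semidirect_product_def closed)
  qed (auto simp: semidirect_product_def closed mult comp one A.m_assoc B.m_assoc)
qed

text \<open>The section lets B act on the kernel of \<open>p\<close> by conjugation, and every
  element of G is a kernel element times a value of the section. The action is pulled back to A
  along the embedding \<open>i\<close>.\<close>

lemma split_extension_iso_semidirect_product:
  assumes "group A" "group G" "group B"
    and i: "i \<in> hom A G" "inj_on i (carrier A)"
    and p: "p \<in> hom G B" and s: "s \<in> hom B G"
    and ps: "\<And>b. b \<in> carrier B \<Longrightarrow> p (s b) = b"
    and exact: "i ` carrier A = kernel G B p"
  shows "\<exists>\<psi>. is_action B A \<psi> \<and> G \<cong> semidirect_product A B \<psi>"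
proof -
  interpret A: group A by fact
  interpret G: group G by fact
  interpret B: group B by fact
  interpret i: group_hom A G i
    using i by (simp add: group_hom_def group_hom_axioms_def A.is_group G.is_group)
  interpret p: group_hom G B p
    using p by (simp add: group_hom_def group_hom_axioms_def B.is_group G.is_group)
  interpret s: group_hom B G s
    using s by (simp add: group_hom_def group_hom_axioms_def B.is_group G.is_group)
  have pi: "p (i a) = \<one>\<^bsub>B\<^esub>" if "a \<in> carrier A" for a
    using exact that by (auto simp: kernel_def)
  define conj where "conj b a = s b \<otimes>\<^bsub>G\<^esub> i a \<otimes>\<^bsub>G\<^esub> inv\<^bsub>G\<^esub> (s b)" for b a
  \<comment> \<open>The restriction to the carrier makes each \<open>\<psi> b\<close> extensional,
    as membership in \<open>auto A\<close> demands.\<close>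
  define \<psi> where "\<psi> b = (\<lambda>a\<in>carrier A. inv_into (carrier A) i (conj b a))" for b
  have "conj b a \<in> i ` carrier A" if "b \<in> carrier B" "a \<in> carrier A" for a b
    using that by (simp add: exact kernel_def conj_def pi ps)
  then have \<psi>: "\<psi> b a \<in> carrier A" "i (\<psi> b a) = conj b a"
    if "b \<in> carrier B" "a \<in> carrier A" for a b
    using that by (auto simp: \<psi>_def inv_into_into f_inv_into_f)
  have \<psi>_ext: "\<psi> b \<in> extensional (carrier A)" for b
    by (simp add: \<psi>_def)
  \<comment> \<open>Identities in A are checked after applying the injective \<open>i\<close>, where
    \<open>\<psi>\<close> becomes conjugation in G.\<close>
  have eq: "x = y" if "i x = i y" "x \<in> carrier A" "y \<in> carrier A" for x y
    using that i(2) by (simp add: inj_onD)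
  have comp: "\<psi> (b \<otimes>\<^bsub>B\<^esub> b') a = \<psi> b (\<psi> b' a)"
    if "b \<in> carrier B" "b' \<in> carrier B" "a \<in> carrier A" for a b b'
    by (rule eq) (use that in \<open>simp_all add: \<psi> conj_def G.m_assoc G.inv_mult_group\<close>)
  have one: "\<psi> \<one>\<^bsub>B\<^esub> a = a" if "a \<in> carrier A" for a
    by (rule eq) (use that in \<open>simp_all add: \<psi> conj_def\<close>)
  have "\<psi> b \<in> auto A" if b: "b \<in> carrier B" for b
  proof -
    have "\<psi> b (a \<otimes>\<^bsub>A\<^esub> a') = \<psi> b a \<otimes>\<^bsub>A\<^esub> \<psi> b a'"
      if a: "a \<in> carrier A" "a' \<in> carrier A" for a a'
    proof (rule eq)
      have "i (\<psi> b (a \<otimes>\<^bsub>A\<^esub> a')) = conj b (a \<otimes>\<^bsub>A\<^esub> a')"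
        using a b by (simp add: \<psi>)
      also have "\<dots> = conj b a \<otimes>\<^bsub>G\<^esub> conj b a'"
        using a b unfolding conj_def
        by (simp add: G.m_assoc) (simp add: G.inv_solve_left' flip: G.m_assoc)
      finally show "i (\<psi> b (a \<otimes>\<^bsub>A\<^esub> a')) = i (\<psi> b a \<otimes>\<^bsub>A\<^esub> \<psi> b a')"
        using a b by (simp add: \<psi>)
    qed (use a b \<psi> in auto)
    moreover have "bij_betw (\<psi> b) (carrier A) (carrier A)"
    proof (rule bij_betw_byWitness[where f' = "\<psi> (inv\<^bsub>B\<^esub> b)"])
      show "\<forall>a\<in>carrier A. \<psi> (inv\<^bsub>B\<^esub> b) (\<psi> b a) = a"
        using b by (simp add: one flip: comp)
      show "\<forall>a\<in>carrier A. \<psi> b (\<psi> (inv\<^bsub>B\<^esub> b) a) = a"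
        using b by (simp add: one flip: comp)
    qed (use b \<psi> in auto)
    ultimately show ?thesis
      using \<psi>(1)[OF b] by (auto simp: auto_def hom_def Bij_def \<psi>_ext)
  qed
  then have act: "is_action B A \<psi>"
    unfolding is_action_iff
    by (auto intro!: extensionalityI[where A = "carrier A"] simp: comp compose_eq \<psi>_ext)
  interpret S: group "semidirect_product A B \<psi>"
    using group_semidirect_product[OF A.is_group B.is_group act] .
  define f where "f = (\<lambda>(a, b). i a \<otimes>\<^bsub>G\<^esub> s b)"
  have hom: "f \<in> hom (semidirect_product A B \<psi>) G"
  proof (rule homI)
    fix z z' assume "z \<in> carrier (semidirect_product A B \<psi>)"
      "z' \<in> carrier (semidirect_product A B \<psi>)"
    then show "f (z \<otimes>\<^bsub>semidirect_product A B \<psi>\<^esub> z') = f z \<otimes>\<^bsub>G\<^esub> f z'"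
      by (auto simp: semidirect_product_def f_def \<psi> conj_def G.m_assoc)
        (simp add: G.inv_solve_left' flip: G.m_assoc)
  qed (auto simp: f_def semidirect_product_def)
  interpret f: group_hom "semidirect_product A B \<psi>" G f
    using hom by (simp add: group_hom_def group_hom_axioms_def S.is_group G.is_group)
  have "f \<in> iso (semidirect_product A B \<psi>) G"
  proof (subst f.iso_iff, intro conjI ballI impI subsetI)
    fix g assume g: "g \<in> carrier G"
    \<comment> \<open>Dividing \<open>g\<close> by the section value over \<open>p g\<close> leaves
      a kernel element, which supplies the first component of a preimage.\<close>
    have "g \<otimes>\<^bsub>G\<^esub> inv\<^bsub>G\<^esub> (s (p g)) \<in> i ` carrier A"
      using g by (simp add: exact kernel_def ps)
    then obtain a where a: "a \<in> carrier A" "i a = g \<otimes>\<^bsub>G\<^esub> inv\<^bsub>G\<^esub> (s (p g))" by auto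
    then have "f (a, p g) = g"
      using g by (simp add: f_def G.m_assoc)
    then show "g \<in> f ` carrier (semidirect_product A B \<psi>)"
      using a g by (intro rev_image_eqI[of "(a, p g)"]) (auto simp: semidirect_product_def)
  next
    fix z assume "z \<in> carrier (semidirect_product A B \<psi>)" and 1: "f z = \<one>\<^bsub>G\<^esub>"
    then obtain a b where z: "z = (a, b)" "a \<in> carrier A" "b \<in> carrier B"
      by (auto simp: semidirect_product_def)
    have "p (f z) = b"
      using z by (simp add: f_def pi ps)
    with 1 have b: "b = \<one>\<^bsub>B\<^esub>" by simp
    with 1 z have "i a = \<one>\<^bsub>G\<^esub>" by (simp add: f_def)
    then have "a = \<one>\<^bsub>A\<^esub>"
      using z by (intro eq) auto
    with z b show "z = \<one>\<^bsub>semidirect_product A B \<psi>\<^esub>"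
      by (simp add: semidirect_product_def)
  qed
  then have "semidirect_product A B \<psi> \<cong> G"
    by (auto simp: is_iso_def)
  then show ?thesis
    using act S.iso_sym by blast
qed

section \<open>Convolution on coefficient functions, reduced to monomials\<close>

section \<open>The group algebra as a ring\<close>

text \<open>The monomial \<open>a g\<close>; sums of these exhaust the group algebra of a finite
  group.\<close>

definition single ::
    "('a, 'm) ring_scheme \<Rightarrow> ('g, 'n) monoid_scheme \<Rightarrow> 'a \<Rightarrow> 'g \<Rightarrow> 'g \<Rightarrow> 'a" where
  "single F G a g = (\<lambda>z\<in>carrier G. if z = g then a else \<zero>\<^bsub>F\<^esub>)"

text \<open>The linear extension of the map sending g to \<chi>(g) \<pi>(g). One formula serves for
  the projection, for its section and for the sign involution. The case distinction inside the
  product keeps the sum over all of G, the shape that \<open>finsum_single\<close>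
  evaluates.\<close>

definition twisted_pushforward ::
    "('a, 'm) ring_scheme \<Rightarrow> ('g, 'n) monoid_scheme \<Rightarrow> ('h, 'l) monoid_scheme \<Rightarrow>
      ('g \<Rightarrow> 'a) \<Rightarrow> ('g \<Rightarrow> 'h) \<Rightarrow> ('g \<Rightarrow> 'a) \<Rightarrow> 'h \<Rightarrow> 'a" where
  "twisted_pushforward F G H \<chi> \<pi> f =
    (\<lambda>z\<in>carrier H. \<Oplus>\<^bsub>F\<^esub>g\<in>carrier G. f g \<otimes>\<^bsub>F\<^esub> (if \<pi> g = z then \<chi> g else \<zero>\<^bsub>F\<^esub>))"

lemma carrier_group_algebra:
  "carrier (group_algebra F G) = carrier G \<rightarrow>\<^sub>E carrier F"
  by (simp add: group_algebra_def)

lemma add_group_algebra: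
  "f \<oplus>\<^bsub>group_algebra F G\<^esub> h = (\<lambda>z\<in>carrier G. f z \<oplus>\<^bsub>F\<^esub> h z)"
  by (simp add: group_algebra_def)

lemma zero_group_algebra:
  "\<zero>\<^bsub>group_algebra F G\<^esub> = (\<lambda>z\<in>carrier G. \<zero>\<^bsub>F\<^esub>)"
  by (simp add: group_algebra_def)

lemma one_group_algebra:
  "\<one>\<^bsub>group_algebra F G\<^esub> = single F G \<one>\<^bsub>F\<^esub> \<one>\<^bsub>G\<^esub>"
  by (simp add: group_algebra_def single_def)

lemma mult_group_algebra:
  "f \<otimes>\<^bsub>group_algebra F G\<^esub> h =
    (\<lambda>z\<in>carrier G. \<Oplus>\<^bsub>F\<^esub>g\<in>carrier G. f g \<otimes>\<^bsub>F\<^esub> h (inv\<^bsub>G\<^esub> g \<otimes>\<^bsub>G\<^esub> z))"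
  by (simp add: group_algebra_def)

lemma group_algebra_eqI:
  assumes "f \<in> carrier (group_algebra F G)" "h \<in> carrier (group_algebra F G)"
    and "\<And>z. z \<in> carrier G \<Longrightarrow> f z = h z"
  shows "f = h"
  using assms by (auto simp: carrier_group_algebra intro: PiE_ext)

locale finite_group_algebra = F: cring F + G: group G
  for F (structure) and G (structure) +
  assumes finite_group: "finite (carrier G)"
begin

abbreviation FG where "FG \<equiv> group_algebra F G"
abbreviation \<delta> where "\<delta> \<equiv> single F G"

lemma coeff_closed [simp]: "f \<in> carrier FG \<Longrightarrow> g \<in> carrier G \<Longrightarrow> f g \<in> carrier F"
  by (auto simp: carrier_group_algebra)

lemma single_closed [simp]: "a \<in> carrier F \<Longrightarrow> \<delta> a g \<in> carrier FG"
  by (auto simp: carrier_group_algebra single_def)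

lemma zero_closed [simp]: "\<zero>\<^bsub>FG\<^esub> \<in> carrier FG"
  by (auto simp: carrier_group_algebra zero_group_algebra)

lemma add_closed [simp]:
  "f \<in> carrier FG \<Longrightarrow> h \<in> carrier FG \<Longrightarrow> f \<oplus>\<^bsub>FG\<^esub> h \<in> carrier FG"
  by (auto simp: carrier_group_algebra add_group_algebra)

lemma mult_closed [simp]:
  "f \<in> carrier FG \<Longrightarrow> h \<in> carrier FG \<Longrightarrow> f \<otimes>\<^bsub>FG\<^esub> h \<in> carrier FG"
  by (auto simp: carrier_group_algebra mult_group_algebra intro!: F.finsum_closed)

lemma finsum_single:
  assumes "a \<in> carrier F" "g \<in> carrier G" "\<phi> \<in> carrier G \<rightarrow> carrier F"
  shows "(\<Oplus>\<^bsub>F\<^esub>g'\<in>carrier G. \<delta> a g g' \<otimes>\<^bsub>F\<^esub> \<phi> g') = a \<otimes>\<^bsub>F\<^esub> \<phi> g"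
proof -
  have "(\<Oplus>\<^bsub>F\<^esub>g'\<in>carrier G. \<delta> a g g' \<otimes>\<^bsub>F\<^esub> \<phi> g') =
      (\<Oplus>\<^bsub>F\<^esub>g'\<in>carrier G. if g = g' then a \<otimes>\<^bsub>F\<^esub> \<phi> g' else \<zero>\<^bsub>F\<^esub>)"
    using assms by (intro F.finsum_cong') (auto simp: single_def Pi_iff)
  also have "\<dots> = a \<otimes>\<^bsub>F\<^esub> \<phi> g"
    using assms finite_group by (intro F.finsum_singleton) auto
  finally show ?thesis .
qed

lemma single_add:
  assumes "a \<in> carrier F" "b \<in> carrier F"
  shows "\<delta> (a \<oplus>\<^bsub>F\<^esub> b) g = \<delta> a g \<oplus>\<^bsub>FG\<^esub> \<delta> b g"
  using assms by (auto simp: single_def add_group_algebra)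

lemma single_zero: "\<delta> \<zero>\<^bsub>F\<^esub> g = \<zero>\<^bsub>FG\<^esub>"
  by (auto simp: single_def zero_group_algebra)

lemma single_mult:
  assumes "a \<in> carrier F" "b \<in> carrier F" "g \<in> carrier G" "h \<in> carrier G"
  shows "\<delta> a g \<otimes>\<^bsub>FG\<^esub> \<delta> b h = \<delta> (a \<otimes>\<^bsub>F\<^esub> b) (g \<otimes>\<^bsub>G\<^esub> h)"
proof (rule group_algebra_eqI[where F = F])
  fix z assume z: "z \<in> carrier G"
  have "(\<delta> a g \<otimes>\<^bsub>FG\<^esub> \<delta> b h) z = a \<otimes>\<^bsub>F\<^esub> \<delta> b h (inv\<^bsub>G\<^esub> g \<otimes>\<^bsub>G\<^esub> z)"
    using assms z by (simp add: mult_group_algebra finsum_single)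
  also have "inv\<^bsub>G\<^esub> g \<otimes>\<^bsub>G\<^esub> z = h \<longleftrightarrow> z = g \<otimes>\<^bsub>G\<^esub> h"
    using assms z G.inv_solve_left' by auto
  then have "a \<otimes>\<^bsub>F\<^esub> \<delta> b h (inv\<^bsub>G\<^esub> g \<otimes>\<^bsub>G\<^esub> z) = \<delta> (a \<otimes>\<^bsub>F\<^esub> b) (g \<otimes>\<^bsub>G\<^esub> h) z"
    using assms z by (simp add: single_def)
  finally show "(\<delta> a g \<otimes>\<^bsub>FG\<^esub> \<delta> b h) z = \<delta> (a \<otimes>\<^bsub>F\<^esub> b) (g \<otimes>\<^bsub>G\<^esub> h) z" .
qed (use assms in auto)

text \<open>Every element is a finite sum of monomials, so a property that is stable under addition
  needs checking on monomials only. Nearly all identities below are proved this way.\<close>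

lemma group_algebra_induct [consumes 1, case_names zero add single]:
  assumes f: "f \<in> carrier FG"
    and zero: "P \<zero>\<^bsub>FG\<^esub>"
    and add: "\<And>f h. f \<in> carrier FG \<Longrightarrow> h \<in> carrier FG \<Longrightarrow> P f \<Longrightarrow> P h \<Longrightarrow> P (f \<oplus>\<^bsub>FG\<^esub> h)"
    and single: "\<And>a g. a \<in> carrier F \<Longrightarrow> g \<in> carrier G \<Longrightarrow> P (\<delta> a g)"
  shows "P f"
proof -
  \<comment> \<open>Truncation of the coefficients of \<open>f\<close> to \<open>S\<close>;
    enlarging \<open>S\<close> by one group element adds one monomial.\<close>
  define cut where "cut S = (\<lambda>z\<in>carrier G. if z \<in> S then f z else \<zero>\<^bsub>F\<^esub>)" for S
  have cut: "cut S \<in> carrier FG" for S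
    using f by (auto simp: cut_def carrier_group_algebra)
  have "P (cut S)" if "finite S" "S \<subseteq> carrier G" for S
    using that
  proof (induction S)
    case empty
    have "cut {} = \<zero>\<^bsub>FG\<^esub>" by (auto simp: cut_def zero_group_algebra)
    with zero show ?case by simp
  next
    case (insert g S)
    have "cut (insert g S) = \<delta> (f g) g \<oplus>\<^bsub>FG\<^esub> cut S"
      using insert.hyps f by (auto simp: cut_def add_group_algebra single_def)
    then show ?case
      using insert f cut by (auto intro!: add single)
  qed
  from this[OF finite_group] have "P (cut (carrier G))" by simp
  also have "cut (carrier G) = f"
    using f cut by (intro group_algebra_eqI[where F = F]) (auto simp: cut_def)
  finally show ?thesis .
qed

lemma add_mult_distrib:
  assumes "f \<in> carrier FG" "f' \<in> carrier FG" "h \<in> carrier FG"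
  shows "(f \<oplus>\<^bsub>FG\<^esub> f') \<otimes>\<^bsub>FG\<^esub> h = f \<otimes>\<^bsub>FG\<^esub> h \<oplus>\<^bsub>FG\<^esub> f' \<otimes>\<^bsub>FG\<^esub> h"
proof (rule group_algebra_eqI[where F = F])
  fix z assume z: "z \<in> carrier G"
  show "((f \<oplus>\<^bsub>FG\<^esub> f') \<otimes>\<^bsub>FG\<^esub> h) z = (f \<otimes>\<^bsub>FG\<^esub> h \<oplus>\<^bsub>FG\<^esub> f' \<otimes>\<^bsub>FG\<^esub> h) z"
    using assms z
    by (simp add: mult_group_algebra add_group_algebra F.l_distr Pi_def cong: F.finsum_cong)
qed (use assms in auto)

lemma mult_add_distrib:
  assumes "f \<in> carrier FG" "f' \<in> carrier FG" "h \<in> carrier FG"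
  shows "h \<otimes>\<^bsub>FG\<^esub> (f \<oplus>\<^bsub>FG\<^esub> f') = h \<otimes>\<^bsub>FG\<^esub> f \<oplus>\<^bsub>FG\<^esub> h \<otimes>\<^bsub>FG\<^esub> f'"
proof (rule group_algebra_eqI[where F = F])
  fix z assume z: "z \<in> carrier G"
  show "(h \<otimes>\<^bsub>FG\<^esub> (f \<oplus>\<^bsub>FG\<^esub> f')) z = (h \<otimes>\<^bsub>FG\<^esub> f \<oplus>\<^bsub>FG\<^esub> h \<otimes>\<^bsub>FG\<^esub> f') z"
    using assms z
    by (simp add: mult_group_algebra add_group_algebra F.r_distr Pi_def cong: F.finsum_cong)
qed (use assms in auto)

lemma abelian_group_group_algebra: "abelian_group FG"
proof (rule abelian_groupI)
  fix f assume f: "f \<in> carrier FG"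
  define h where "h = (\<lambda>z\<in>carrier G. \<ominus>\<^bsub>F\<^esub> f z)"
  have "h \<in> carrier FG"
    using f by (auto simp: h_def carrier_group_algebra)
  moreover have "h \<oplus>\<^bsub>FG\<^esub> f = \<zero>\<^bsub>FG\<^esub>"
    using f by (auto simp: h_def add_group_algebra zero_group_algebra F.l_neg)
  ultimately show "\<exists>h\<in>carrier FG. h \<oplus>\<^bsub>FG\<^esub> f = \<zero>\<^bsub>FG\<^esub>" by blast
qed (auto intro!: group_algebra_eqI[where F = F] simp: add_group_algebra zero_group_algebra
    carrier_group_algebra PiE_iff F.a_ac)

sublocale FG: abelian_group FG
  by (rule abelian_group_group_algebra)

lemma zero_mult: "f \<in> carrier FG \<Longrightarrow> \<zero>\<^bsub>FG\<^esub> \<otimes>\<^bsub>FG\<^esub> f = \<zero>\<^bsub>FG\<^esub>"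
  using add_mult_distrib[of "\<zero>\<^bsub>FG\<^esub>" "\<zero>\<^bsub>FG\<^esub>" f] FG.add.r_cancel_one by simp

lemma mult_zero: "f \<in> carrier FG \<Longrightarrow> f \<otimes>\<^bsub>FG\<^esub> \<zero>\<^bsub>FG\<^esub> = \<zero>\<^bsub>FG\<^esub>"
  using mult_add_distrib[of "\<zero>\<^bsub>FG\<^esub>" "\<zero>\<^bsub>FG\<^esub>" f] FG.add.r_cancel_one by simp

text \<open>Associativity is additive in each of the three factors, so nested inductions reduce it
  to monomials, where it follows from associativity in F and in G. No double convolution sum has to
  be rearranged.\<close>

lemma ring_group_algebra: "ring FG"
proof (rule ringI)
  show "Group.monoid FG"
  proof (rule monoidI)
    fix f g h assume fgh: "f \<in> carrier FG" "g \<in> carrier FG" "h \<in> carrier FG"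
    from fgh(1) show "f \<otimes>\<^bsub>FG\<^esub> g \<otimes>\<^bsub>FG\<^esub> h = f \<otimes>\<^bsub>FG\<^esub> (g \<otimes>\<^bsub>FG\<^esub> h)"
    proof (induction rule: group_algebra_induct)
      case f: (single a x)
      from fgh(2) show ?case
      proof (induction rule: group_algebra_induct)
        case g: (single b y)
        from fgh(3) show ?case
          by (induction rule: group_algebra_induct)
            (use f g in \<open>auto simp: mult_zero mult_add_distrib single_mult F.m_assoc G.m_assoc\<close>)
      qed (use f fgh in \<open>auto simp: zero_mult mult_zero add_mult_distrib mult_add_distrib\<close>)
    qed (use fgh in \<open>auto simp: zero_mult add_mult_distrib\<close>)
  next
    fix f assume "f \<in> carrier FG"
    then show "\<one>\<^bsub>FG\<^esub> \<otimes>\<^bsub>FG\<^esub> f = f"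
      by (induction rule: group_algebra_induct)
        (auto simp: one_group_algebra mult_zero mult_add_distrib single_mult)
  next
    fix f assume "f \<in> carrier FG"
    then show "f \<otimes>\<^bsub>FG\<^esub> \<one>\<^bsub>FG\<^esub> = f"
      by (induction rule: group_algebra_induct)
        (auto simp: one_group_algebra zero_mult add_mult_distrib single_mult)
  qed (auto simp: one_group_algebra)
qed (auto simp: add_mult_distrib mult_add_distrib abelian_group_group_algebra)

sublocale FG: ring FG
  by (rule ring_group_algebra)

lemma card_group_algebra: "card (carrier FG) = card (carrier F) ^ card (carrier G)"
  using finite_group by (simp add: carrier_group_algebra card_PiE)

lemma finite_group_algebra: "finite (carrier F) \<Longrightarrow> finite (carrier FG)"
  using finite_group by (simp add: carrier_group_algebra finite_PiE)

lemma cring_group_algebra: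
  assumes "comm_group G"
  shows "cring FG"
proof -
  interpret G: comm_group G by fact
  have "f \<otimes>\<^bsub>FG\<^esub> h = h \<otimes>\<^bsub>FG\<^esub> f" if fh: "f \<in> carrier FG" "h \<in> carrier FG" for f h
    using fh(1)
  proof (induction rule: group_algebra_induct)
    case f: (single a g)
    from fh(2) show ?case
      by (induction rule: group_algebra_induct)
        (use f in \<open>auto simp: FG.l_distr FG.r_distr single_mult F.m_comm G.m_comm\<close>)
  qed (use fh in \<open>auto simp: FG.l_distr FG.r_distr\<close>)
  then show ?thesis
    by (intro cring.intro comm_monoid.intro comm_monoid_axioms.intro ring_group_algebra
        FG.monoid_axioms)
qed

text \<open>On monomials multiplicativity is that of \<chi> and \<pi>, together with commutativity
  of F; additivity in both factors carries it to all elements. The second conclusion gives the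
  values on monomials, which is how these maps are computed with later.\<close>

lemma twisted_pushforward_ring_hom:
  assumes "finite_group_algebra F H" and \<pi>: "\<pi> \<in> hom G H"
    and \<chi>: "\<And>g. g \<in> carrier G \<Longrightarrow> \<chi> g \<in> carrier F"
    and \<chi>_mult: "\<And>g h. g \<in> carrier G \<Longrightarrow> h \<in> carrier G \<Longrightarrow> \<chi> (g \<otimes>\<^bsub>G\<^esub> h) = \<chi> g \<otimes>\<^bsub>F\<^esub> \<chi> h"
    and \<chi>_one: "\<chi> \<one>\<^bsub>G\<^esub> = \<one>\<^bsub>F\<^esub>"
  shows "twisted_pushforward F G H \<chi> \<pi> \<in> ring_hom FG (group_algebra F H)"
    and "\<And>a g. a \<in> carrier F \<Longrightarrow> g \<in> carrier G \<Longrightarrow>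
      twisted_pushforward F G H \<chi> \<pi> (\<delta> a g) = single F H (\<chi> g \<otimes>\<^bsub>F\<^esub> a) (\<pi> g)"
proof -
  interpret H: finite_group_algebra F H by fact
  interpret \<pi>: group_hom G H \<pi>
    using \<pi> by (simp add: group_hom_def group_hom_axioms_def G.is_group H.G.is_group)
  let ?P = "twisted_pushforward F G H \<chi> \<pi>"
  have closed: "?P f \<in> carrier H.FG" if "f \<in> carrier FG" for f
    using that \<chi> unfolding twisted_pushforward_def
    by (auto simp: carrier_group_algebra PiE_iff intro!: F.finsum_closed)
  show single: "?P (\<delta> a g) = single F H (\<chi> g \<otimes>\<^bsub>F\<^esub> a) (\<pi> g)"
    if "a \<in> carrier F" "g \<in> carrier G" for a g
    unfolding twisted_pushforward_def
    by (rule ext, subst restrict_def, subst finsum_single)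
      (use that \<chi> in \<open>auto simp: single_def F.m_comm\<close>)
  have add: "?P (f \<oplus>\<^bsub>FG\<^esub> h) = ?P f \<oplus>\<^bsub>H.FG\<^esub> ?P h"
    if "f \<in> carrier FG" "h \<in> carrier FG" for f h
  proof (rule group_algebra_eqI[where F = F])
    fix z assume z: "z \<in> carrier H"
    show "?P (f \<oplus>\<^bsub>FG\<^esub> h) z = (?P f \<oplus>\<^bsub>H.FG\<^esub> ?P h) z"
      using that z \<chi>
      by (simp add: twisted_pushforward_def add_group_algebra F.l_distr Pi_def
          cong: F.finsum_cong)
  qed (use that closed in auto)
  \<comment> \<open>The zero element is a monomial with coefficient zero, so \<open>single\<close>
    yields its image.\<close>
  have zero: "?P \<zero>\<^bsub>FG\<^esub> = \<zero>\<^bsub>H.FG\<^esub>"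
    using single[of "\<zero>\<^bsub>F\<^esub>" "\<one>\<^bsub>G\<^esub>"] \<chi> by (simp add: single_zero H.single_zero)
  have mult: "?P (f \<otimes>\<^bsub>FG\<^esub> h) = ?P f \<otimes>\<^bsub>H.FG\<^esub> ?P h"
    if fh: "f \<in> carrier FG" "h \<in> carrier FG" for f h
    using fh(1)
  proof (induction rule: group_algebra_induct)
    case f: (single a g)
    from fh(2) show ?case
    proof (induction rule: group_algebra_induct)
      case h: (single b x)
      show ?case
        using f h \<chi> by (simp add: single_mult single H.single_mult \<chi>_mult F.m_ac)
    qed (use f closed in \<open>auto simp: zero add FG.r_distr H.FG.r_distr\<close>)
  qed (use fh closed in \<open>auto simp: zero add FG.l_distr H.FG.l_distr\<close>)
  show "?P \<in> ring_hom FG H.FG"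
    by (rule ring_hom_memI)
      (auto simp: closed add mult one_group_algebra single \<chi>_one)
qed

end

section \<open>The unipotent kernel as a group of pairs, and its splitting in characteristic
  3\<close>

section \<open>The twisted group on pairs\<close>

text \<open>A central extension of the additive group of B by itself, with cocycle
  \<open>\<tau> b \<otimes> b'\<close>. The cocycle comes from (t b)(t b') = t^2 \<tau>(b)
  b'.\<close>

definition twisted_square :: "('b, 'm) ring_scheme \<Rightarrow> ('b \<Rightarrow> 'b) \<Rightarrow> ('b \<times> 'b) monoid" where
  "twisted_square B \<tau> =
    \<lparr>carrier = carrier B \<times> carrier B,
     monoid.mult = (\<lambda>(b, c) (b', c'). (b \<oplus>\<^bsub>B\<^esub> b', c \<oplus>\<^bsub>B\<^esub> c' \<oplus>\<^bsub>B\<^esub> \<tau> b \<otimes>\<^bsub>B\<^esub> b')),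
     one = (\<zero>\<^bsub>B\<^esub>, \<zero>\<^bsub>B\<^esub>)\<rparr>"

locale char3_ring = ring +
  assumes three_eq_zero: "\<one> \<oplus> \<one> \<oplus> \<one> = \<zero>"
begin

text \<open>The right-nested form of this rule and the next matches sums sorted by
  \<open>a_ac\<close>, in which equal summands are neighbours and can be cancelled in
  threes.\<close>

lemma triple [simp]: "x \<in> carrier R \<Longrightarrow> x \<oplus> (x \<oplus> x) = \<zero>"
proof -
  assume x: "x \<in> carrier R"
  have "x \<oplus> (x \<oplus> x) = (\<one> \<oplus> \<one> \<oplus> \<one>) \<otimes> x"
    using x by (simp add: l_distr a_assoc)
  then show ?thesis using x by (simp add: three_eq_zero)
qed

lemma triple_add [simp]:
  "x \<in> carrier R \<Longrightarrow> z \<in> carrier R \<Longrightarrow> x \<oplus> (x \<oplus> (x \<oplus> z)) = z"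
  using triple[of x] by (metis a_assoc a_closed l_zero)

text \<open>Writing negatives as repeated summands reduces identities in characteristic 3 to sorting
  sums and cancelling triples.\<close>

lemma neg_eq_double: "x \<in> carrier R \<Longrightarrow> \<ominus> x = x \<oplus> x"
  by (rule minus_equality) (simp_all add: a_assoc)

end

locale char3_involution = cring B + char3_ring B for B (structure) +
  fixes \<tau>
  assumes \<tau>_hom: "\<tau> \<in> ring_hom B B"
    and \<tau>_\<tau>: "b \<in> carrier B \<Longrightarrow> \<tau> (\<tau> b) = b"
begin

abbreviation V where "V \<equiv> twisted_square B \<tau>"
abbreviation fixed where "fixed \<equiv> {b \<in> carrier B. \<tau> b = b}"
abbreviation antifixed where "antifixed \<equiv> {b \<in> carrier B. \<tau> b = \<ominus> b}"

lemma \<tau>_simps [simp]: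
  "b \<in> carrier B \<Longrightarrow> \<tau> b \<in> carrier B"
  "b \<in> carrier B \<Longrightarrow> c \<in> carrier B \<Longrightarrow> \<tau> (b \<oplus> c) = \<tau> b \<oplus> \<tau> c"
  "b \<in> carrier B \<Longrightarrow> c \<in> carrier B \<Longrightarrow> \<tau> (b \<otimes> c) = \<tau> b \<otimes> \<tau> c"
  "\<tau> \<zero> = \<zero>"
  "b \<in> carrier B \<Longrightarrow> \<tau> (\<ominus> b) = \<ominus> \<tau> b"
proof -
  interpret ring_hom_ring B B \<tau>
    using \<tau>_hom by (intro ring_hom_ringI2) (rule ring_axioms)+
  show "b \<in> carrier B \<Longrightarrow> \<tau> b \<in> carrier B"
    "b \<in> carrier B \<Longrightarrow> c \<in> carrier B \<Longrightarrow> \<tau> (b \<oplus> c) = \<tau> b \<oplus> \<tau> c"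
    "b \<in> carrier B \<Longrightarrow> c \<in> carrier B \<Longrightarrow> \<tau> (b \<otimes> c) = \<tau> b \<otimes> \<tau> c"
    "\<tau> \<zero> = \<zero>"
    "b \<in> carrier B \<Longrightarrow> \<tau> (\<ominus> b) = \<ominus> \<tau> b"
    by auto
qed

lemmas char3_simps = l_distr r_distr a_ac m_ac neg_eq_double a_minus_def

lemma carrier_V: "carrier V = carrier B \<times> carrier B"
  and one_V: "\<one>\<^bsub>V\<^esub> = (\<zero>, \<zero>)"
  and mult_V: "(b, c) \<otimes>\<^bsub>V\<^esub> (b', c') = (b \<oplus> b', c \<oplus> c' \<oplus> \<tau> b \<otimes> b')"
  by (simp_all add: twisted_square_def)

lemma group_V: "group V"
proof (rule groupI)
  fix x assume "x \<in> carrier V"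
  then obtain b c where x: "x = (b, c)" "b \<in> carrier B" "c \<in> carrier B"
    by (auto simp: carrier_V)
  show "\<exists>y\<in>carrier V. y \<otimes>\<^bsub>V\<^esub> x = \<one>\<^bsub>V\<^esub>"
    \<comment> \<open>The summand \<open>\<tau> b \<otimes> b\<close> compensates the cocycle value
      \<open>\<tau> (\<ominus> b) \<otimes> b\<close> that arises in the product.\<close>
    using x by (intro bexI[of _ "(\<ominus> b, \<ominus> c \<oplus> \<tau> b \<otimes> b)"])
      (simp_all add: carrier_V one_V mult_V char3_simps)
qed (auto simp: carrier_V one_V mult_V char3_simps)

text \<open>Since 2 is invertible, B is the direct sum of the eigenspaces of \<tau> for 1 and -1.
  Multiplication by the unit \<open>y\<close>, itself in the second one, exchanges them, so each has
  the square root of the size of B.\<close>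

lemma card_eigenspaces:
  assumes y: "y \<in> Units B" "\<tau> y = \<ominus> y" and fin: "finite (carrier B)"
  shows "card antifixed = card fixed" and "card fixed * card fixed = card (carrier B)"
proof -
  have yB: "y \<in> carrier B" "inv y \<in> carrier B" "inv y \<otimes> y = \<one>" "y \<otimes> inv y = \<one>"
    using y by auto
  \<comment> \<open>Applying \<tau> to \<open>inv y \<otimes> y = \<one>\<close> shows that the
    inverse of \<open>y\<close> is also negated by \<tau>, which makes division by \<open>y\<close>
    map back between the eigenspaces.\<close>
  have "\<tau> (inv y) \<otimes> \<ominus> y = \<tau> \<one>"
    using yB y(2) by (metis \<tau>_simps(3))
  also have "\<tau> \<one> = \<one>" using \<tau>_hom by (simp add: ring_hom_one)
  finally have "\<ominus> (\<tau> (inv y)) \<otimes> y = \<one>"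
    using yB by (simp add: l_minus r_minus)
  then have "inv y = \<ominus> (\<tau> (inv y))"
    using yB by (intro inv_char) (auto simp: m_comm)
  then have \<tau>_inv: "\<tau> (inv y) = \<ominus> (inv y)"
    using yB by (metis minus_minus \<tau>_simps(1))
  have cancel: "y \<otimes> (inv y \<otimes> b) = b" "inv y \<otimes> (y \<otimes> b) = b" if "b \<in> carrier B" for b
    using that yB by (simp_all flip: m_assoc)
  have "bij_betw (\<lambda>b. y \<otimes> b) fixed antifixed"
    by (rule bij_betw_byWitness[where f' = "\<lambda>b. inv y \<otimes> b"])
      (use yB y(2) in \<open>auto simp: cancel \<tau>_inv l_minus r_minus\<close>)
  then show eq: "card antifixed = card fixed"
    by (simp add: bij_betw_same_card)
  have "bij_betw (\<lambda>(u, v). u \<oplus> v) (fixed \<times> antifixed) (carrier B)"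
    \<comment> \<open>The usual projections (b + \<tau>(b))/2 and (b - \<tau>(b))/2, with 1/2 =
      -1.\<close>
    by (rule bij_betw_byWitness[where f' = "\<lambda>b. (\<ominus> (b \<oplus> \<tau> b), \<tau> b \<ominus> b)"])
      (auto simp: \<tau>_\<tau> char3_simps)
  then have "card (fixed \<times> antifixed) = card (carrier B)"
    by (rule bij_betw_same_card)
  with eq show "card fixed * card fixed = card (carrier B)"
    by (simp add: card_cartesian_product)
qed

text \<open>For fixed first coordinates the cocycle is the symmetric form b b', so the group is
  commutative. The cube of (b, c) is (3b, 3c + 3b^2), which vanishes.\<close>

lemma iso_cyclic_power_fixed_part:
  assumes "finite (carrier B)" "card (fixed \<times> carrier B) = 3 ^ m"
  shows "cyclic_power 3 m \<cong> V\<lparr>carrier := fixed \<times> carrier B\<rparr>"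
proof -
  let ?M = "V\<lparr>carrier := fixed \<times> carrier B\<rparr>"
  have "comm_group ?M"
  proof (rule comm_groupI)
    fix x assume "x \<in> carrier ?M"
    then obtain b c where x: "x = (b, c)" "b \<in> carrier B" "\<tau> b = b" "c \<in> carrier B"
      by auto
    show "\<exists>y\<in>carrier ?M. y \<otimes>\<^bsub>?M\<^esub> x = \<one>\<^bsub>?M\<^esub>"
      using x by (intro bexI[of _ "(\<ominus> b, \<ominus> c \<oplus> \<tau> b \<otimes> b)"])
        (simp_all add: carrier_V one_V mult_V char3_simps)
  qed (auto simp: carrier_V one_V mult_V char3_simps)
  then interpret M: comm_group ?M .
  show ?thesis
  proof (rule M.iso_cyclic_power)
    fix x assume "x \<in> carrier ?M"
    then show "x [^]\<^bsub>?M\<^esub> (3::nat) = \<one>\<^bsub>?M\<^esub>"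
      by (auto simp: eval_nat_numeral one_V mult_V char3_simps)
  qed (use assms in auto)
qed

text \<open>The complement inside V consists of pairs determined by their first coordinate, so it is
  described through the additive group of these coordinates.\<close>

lemma iso_cyclic_power_antifixed:
  assumes "finite (carrier B)" "card antifixed = 3 ^ m"
  shows "cyclic_power 3 m \<cong> (add_monoid B)\<lparr>carrier := antifixed\<rparr>"
proof -
  let ?K = "(add_monoid B)\<lparr>carrier := antifixed\<rparr>"
  have "comm_group ?K"
  proof (rule comm_groupI)
    fix x assume "x \<in> carrier ?K"
    then show "\<exists>y\<in>carrier ?K. y \<otimes>\<^bsub>?K\<^esub> x = \<one>\<^bsub>?K\<^esub>"
      by (intro bexI[of _ "\<ominus> x"]) (simp_all add: l_neg)
  qed (auto simp: char3_simps)
  then interpret K: comm_group ?K .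
  show ?thesis
  proof (rule K.iso_cyclic_power)
    fix x assume "x \<in> carrier ?K"
    then show "x [^]\<^bsub>?K\<^esub> (3::nat) = \<one>\<^bsub>?K\<^esub>"
      by (auto simp: eval_nat_numeral a_assoc)
  qed (use assms in auto)
qed

text \<open>First coordinates simply add in V, so taking the antifixed component of the first
  coordinate is a homomorphism. Its kernel is \<open>fixed \<times> carrier B\<close>, of order 3^m
  3^(2m) = 3^(3m).\<close>

lemma twisted_square_iso_semidirect_product:
  assumes y: "y \<in> Units B" "\<tau> y = \<ominus> y"
    and fin: "finite (carrier B)" and card: "card (carrier B) = 3 ^ (2 * m)"
  shows "\<exists>\<phi>. is_action (cyclic_power 3 m) (cyclic_power 3 (3 * m)) \<phi> \<and>
    V \<cong> semidirect_product (cyclic_power 3 (3 * m)) (cyclic_power 3 m) \<phi>"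
proof -
  let ?M = "V\<lparr>carrier := fixed \<times> carrier B\<rparr>"
  let ?K = "(add_monoid B)\<lparr>carrier := antifixed\<rparr>"
  have "(card fixed)\<^sup>2 = (3 ^ m)\<^sup>2"
    using card_eigenspaces(2)[OF y fin] card by (simp add: power2_eq_square mult_2 power_add)
  then have cf: "card fixed = 3 ^ m"
    by (simp add: power2_eq_iff_nonneg)
  have "card (fixed \<times> carrier B) = 3 ^ (3 * m)"
    by (simp add: card_cartesian_product cf card flip: power_add)
  from iso_cyclic_power_fixed_part[OF fin this]
  obtain \<alpha> where \<alpha>: "\<alpha> \<in> iso (cyclic_power 3 (3 * m)) ?M" by (auto simp: is_iso_def)
  have "card antifixed = 3 ^ m"
    using card_eigenspaces(1)[OF y fin] cf by simp
  from iso_cyclic_power_antifixed[OF fin this]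
  obtain \<kappa> where \<kappa>: "\<kappa> \<in> iso (cyclic_power 3 m) ?K" by (auto simp: is_iso_def)
  define \<kappa>' where "\<kappa>' = inv_into (carrier (cyclic_power 3 m)) \<kappa>"
  have \<kappa>': "\<kappa>' \<in> iso ?K (cyclic_power 3 m)"
    unfolding \<kappa>'_def by (rule group.iso_set_sym[OF group_cyclic_power \<kappa>])
  have \<kappa>'_\<kappa>: "\<kappa>' (\<kappa> e) = e" if "e \<in> carrier (cyclic_power 3 m)" for e
    using \<kappa> that by (auto simp: \<kappa>'_def iso_def bij_betw_def)
  have \<kappa>_mem: "\<kappa> e \<in> carrier B" "\<tau> (\<kappa> e) = \<ominus> \<kappa> e" if "e \<in> carrier (cyclic_power 3 m)" for e
    using \<kappa> that by (auto simp: iso_def hom_def Pi_iff)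
  have \<kappa>_mult: "\<kappa> (e \<otimes>\<^bsub>cyclic_power 3 m\<^esub> e') = \<kappa> e \<oplus> \<kappa> e'"
    if "e \<in> carrier (cyclic_power 3 m)" "e' \<in> carrier (cyclic_power 3 m)" for e e'
    using \<kappa> that by (auto simp: iso_def hom_def)
  have \<kappa>'_mult: "\<kappa>' (b \<oplus> b') = \<kappa>' b \<otimes>\<^bsub>cyclic_power 3 m\<^esub> \<kappa>' b'"
    if "b \<in> antifixed" "b' \<in> antifixed" for b b'
    using \<kappa>' that by (auto simp: iso_def hom_def)
  have \<kappa>'_mem: "\<kappa>' b \<in> carrier (cyclic_power 3 m)" if "b \<in> antifixed" for b
    using \<kappa>' that by (auto simp: iso_def hom_def)
  have \<kappa>'_one: "\<kappa>' b = \<one>\<^bsub>cyclic_power 3 m\<^esub> \<longleftrightarrow> b = \<zero>" if "b \<in> antifixed" for b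
  proof -
    have "\<kappa> \<one>\<^bsub>cyclic_power 3 m\<^esub> = \<zero>"
      using \<kappa>_mult[of "\<one>\<^bsub>cyclic_power 3 m\<^esub>" "\<one>\<^bsub>cyclic_power 3 m\<^esub>"]
        \<kappa>_mem[of "\<one>\<^bsub>cyclic_power 3 m\<^esub>"] group.is_monoid[OF group_cyclic_power]
      by (simp add: monoid.one_closed)
    moreover have "\<kappa> (\<kappa>' b) = b"
      using \<kappa> that by (auto simp: \<kappa>'_def iso_def bij_betw_def f_inv_into_f)
    ultimately show ?thesis
      using \<kappa>'_\<kappa> group.is_monoid[OF group_cyclic_power] by (metis monoid.one_closed)
  qed
  have proj: "\<tau> b \<ominus> b \<in> antifixed" if "b \<in> carrier B" for b
    using that by (simp add: \<tau>_\<tau> char3_simps)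
  \<comment> \<open>The antifixed component (b - \<tau>(b))/2 equals \<tau>(b) - b because 1/2 = -1;
    \<open>\<kappa>'\<close> reads off its coordinates.\<close>
  define p where "p = (\<lambda>(b, c :: 'a). \<kappa>' (\<tau> b \<ominus> b))"
  \<comment> \<open>For antifixed b and b' the second coordinate of (b, b^2)(b', b'^2) is b^2 + b'^2
    - b b', which is (b + b')^2 as -1 = 2. The squares thus make the section multiplicative.\<close>
  define s where "s e = (\<kappa> e, \<kappa> e \<otimes> \<kappa> e)" for e
  have p_ker: "p (b, c) = \<one>\<^bsub>cyclic_power 3 m\<^esub> \<longleftrightarrow> \<tau> b = b" if "b \<in> carrier B" for b c
    using \<kappa>'_one[OF proj[OF that]] that by (simp add: p_def)
  show ?thesis
  proof (rule split_extension_iso_semidirect_product[where i = \<alpha> and p = p and s = s])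
    show "\<alpha> \<in> hom (cyclic_power 3 (3 * m)) V"
      using \<alpha> by (auto simp: iso_def hom_def carrier_V Pi_iff)
    show "inj_on \<alpha> (carrier (cyclic_power 3 (3 * m)))"
      using \<alpha> by (auto simp: iso_def bij_betw_def)
    show "p \<in> hom V (cyclic_power 3 m)"
    proof (rule homI)
      fix x x' assume "x \<in> carrier V" "x' \<in> carrier V"
      then obtain b c b' c' where x: "x = (b, c)" "x' = (b', c')"
        "b \<in> carrier B" "b' \<in> carrier B" "c \<in> carrier B" "c' \<in> carrier B"
        by (auto simp: carrier_V)
      have "\<tau> (b \<oplus> b') \<ominus> (b \<oplus> b') = (\<tau> b \<ominus> b) \<oplus> (\<tau> b' \<ominus> b')"
        using x by (simp add: char3_simps)
      then show "p (x \<otimes>\<^bsub>V\<^esub> x') = p x \<otimes>\<^bsub>cyclic_power 3 m\<^esub> p x'"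
        using x proj by (simp add: p_def mult_V \<kappa>'_mult del: \<tau>_simps)
    qed (use proj \<kappa>'_mem in \<open>auto simp: p_def carrier_V\<close>)
    show "s \<in> hom (cyclic_power 3 m) V"
      by (rule homI) (simp_all add: s_def carrier_V mult_V \<kappa>_mem \<kappa>_mult char3_simps)
    show "p (s e) = e" if e: "e \<in> carrier (cyclic_power 3 m)" for e
    proof -
      \<comment> \<open>For an antifixed element b the projection gives -2b = b.\<close>
      have "\<tau> (\<kappa> e) \<ominus> \<kappa> e = \<kappa> e"
        using \<kappa>_mem[OF e] by (simp add: char3_simps)
      then show ?thesis
        using e by (simp add: p_def s_def \<kappa>'_\<kappa>)
    qed
    have "\<alpha> ` carrier (cyclic_power 3 (3 * m)) = fixed \<times> carrier B"
      using \<alpha> by (auto simp: iso_def bij_betw_def)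
    also have "\<dots> = kernel V (cyclic_power 3 m) p"
      using p_ker by (auto simp: kernel_def carrier_V)
    finally show "\<alpha> ` carrier (cyclic_power 3 (3 * m)) = kernel V (cyclic_power 3 m) p" .
  qed (auto simp: group_V)
qed

end

section \<open>From the filtration by powers of t to the unit group\<close>

section \<open>Units of group algebras of extensions by \<open>C\<^sub>3\<close>\<close>

text \<open>Expanding the product of two elements 1 + t b + t^2 c, moving coefficients past t with
  \<tau> and dropping t^3 reproduces the multiplication of pairs. Uniqueness of the expansion in
  powers of t is not assumed; it follows from spanning and counting.\<close>

lemma twisted_square_embedding:
  fixes A (structure)
  assumes "ring A" and B: "char3_involution B \<tau>"
    and s: "s \<in> ring_hom B A" and P: "P \<in> ring_hom A B"
    and Ps: "\<And>b. b \<in> carrier B \<Longrightarrow> P (s b) = b"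
    and t: "t \<in> carrier A" "t \<otimes> (t \<otimes> t) = \<zero>" "P t = \<zero>\<^bsub>B\<^esub>"
    and st: "\<And>b. b \<in> carrier B \<Longrightarrow> s b \<otimes> t = t \<otimes> s (\<tau> b)"
    and gen: "\<And>f. f \<in> carrier A \<Longrightarrow> \<exists>a\<in>carrier B. \<exists>b\<in>carrier B. \<exists>c\<in>carrier B.
      f = s a \<oplus> t \<otimes> s b \<oplus> t \<otimes> (t \<otimes> s c)"
    and fin: "finite (carrier B)" and card: "card (carrier A) = card (carrier B) ^ 3"
  defines "e \<equiv> \<lambda>(b, c). \<one> \<oplus> t \<otimes> s b \<oplus> t \<otimes> (t \<otimes> s c)"
  shows "e \<in> hom (twisted_square B \<tau>) (units_of A)"
    and "inj_on e (carrier (twisted_square B \<tau>))"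
    and "e ` carrier (twisted_square B \<tau>) = kernel (units_of A) (units_of B) P"
proof -
  interpret A: ring A by fact
  interpret B: char3_involution B \<tau> by fact
  interpret V: group "twisted_square B \<tau>" by (rule B.group_V)
  interpret s: ring_hom_ring B A s
    using s by (intro ring_hom_ringI2 B.ring_axioms A.ring_axioms)
  interpret P: ring_hom_ring A B P
    using P by (intro ring_hom_ringI2 B.ring_axioms A.ring_axioms)
  have tz: "t \<otimes> (t \<otimes> (t \<otimes> z)) = \<zero>" if "z \<in> carrier A" for z
    using t that by (metis A.m_assoc A.m_closed A.l_null)
  have stz: "s b \<otimes> (t \<otimes> z) = t \<otimes> (s (\<tau> b) \<otimes> z)" if "b \<in> carrier B" "z \<in> carrier A" for b z
    using st[OF that(1)] t that by (metis A.m_assoc B.\<tau>_simps(1) s.hom_closed)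
  have e_closed: "e v \<in> carrier A" if "v \<in> carrier B.V" for v
    using that t by (auto simp: e_def B.carrier_V)
  have e_mult: "e (v \<otimes>\<^bsub>B.V\<^esub> w) = e v \<otimes> e w" if "v \<in> carrier B.V" "w \<in> carrier B.V" for v w
    using that t
    by (auto simp: e_def B.carrier_V B.mult_V A.l_distr A.r_distr A.m_assoc st stz tz A.a_ac)
  have e_one: "e \<one>\<^bsub>B.V\<^esub> = \<one>"
    using t by (simp add: e_def B.one_V)
  \<comment> \<open>V is a group and \<open>e\<close> is multiplicative, so the inverse of
    \<open>e v\<close> is the image of the inverse of \<open>v\<close>.\<close>
  have e_unit: "e v \<in> Units A" if v: "v \<in> carrier B.V" for v
  proof -
    have "e (inv\<^bsub>B.V\<^esub> v) \<otimes> e v = \<one>" "e v \<otimes> e (inv\<^bsub>B.V\<^esub> v) = \<one>"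
      using v by (simp_all add: e_one flip: e_mult)
    then show ?thesis
      using v e_closed[of v] e_closed[of "inv\<^bsub>B.V\<^esub> v"] by (auto simp: Units_def)
  qed
  show "e \<in> hom B.V (units_of A)"
    by (rule homI) (simp_all add: units_of_carrier units_of_mult e_unit e_mult)
  \<comment> \<open>The full expansion map. It is onto by \<open>gen\<close> and its domain has as
    many elements as A, hence it is injective; \<open>e\<close> is its restriction to leading
    coefficient 1.\<close>
  define D where "D = (\<lambda>(a, b, c). s a \<oplus> t \<otimes> s b \<oplus> t \<otimes> (t \<otimes> s c))"
  let ?T = "carrier B \<times> carrier B \<times> carrier B"
  have "D ` ?T = carrier A"
  proof (intro equalityI subsetI)
    fix f assume "f \<in> carrier A"
    from gen[OF this] obtain a b c where "a \<in> carrier B" "b \<in> carrier B" "c \<in> carrier B"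
      "f = D (a, b, c)" by (auto simp: D_def)
    then show "f \<in> D ` ?T" by (intro image_eqI[of _ _ "(a, b, c)"]) auto
  qed (use t in \<open>auto simp: D_def\<close>)
  moreover have "card (carrier A) = card ?T"
    by (simp add: card card_cartesian_product power3_eq_cube)
  ultimately have inj: "inj_on D ?T"
    using fin by (intro eq_card_imp_inj_on) auto
  have e_D: "e (b, c) = D (\<one>\<^bsub>B\<^esub>, b, c)" for b c
    by (simp add: e_def D_def)
  show "inj_on e (carrier B.V)"
    using inj_onD[OF inj, of "(\<one>\<^bsub>B\<^esub>, _, _)" "(\<one>\<^bsub>B\<^esub>, _, _)"]
    by (auto simp: B.carrier_V e_D intro!: inj_onI)
  \<comment> \<open>As \<open>P\<close> kills t, it reads off the leading coefficient, so the units
    in its kernel are exactly those with leading coefficient 1.\<close>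
  have P_D: "P (D (a, b, c)) = a" if "a \<in> carrier B" "b \<in> carrier B" "c \<in> carrier B" for a b c
    using that t by (simp add: D_def Ps)
  show "e ` carrier B.V = kernel (units_of A) (units_of B) P"
  proof (intro equalityI subsetI)
    fix u assume "u \<in> e ` carrier B.V"
    then show "u \<in> kernel (units_of A) (units_of B) P"
      using e_unit by (auto simp: kernel_def units_of_carrier units_of_one B.carrier_V e_D P_D)
  next
    fix u assume "u \<in> kernel (units_of A) (units_of B) P"
    then have u: "u \<in> carrier A" "P u = \<one>\<^bsub>B\<^esub>"
      by (auto simp: kernel_def units_of_carrier units_of_one)
    from gen[OF u(1)] obtain a b c where abc: "a \<in> carrier B" "b \<in> carrier B" "c \<in> carrier B"
      "u = D (a, b, c)" by (auto simp: D_def)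
    with u(2) have "a = \<one>\<^bsub>B\<^esub>" by (simp add: P_D)
    with abc show "u \<in> e ` carrier B.V"
      by (auto simp: B.carrier_V e_D intro!: rev_image_eqI[of "(b, c)"])
  qed
qed

lemma ring_hom_units:
  assumes "ring R" "ring S" "f \<in> ring_hom R S"
  shows "f \<in> hom (units_of R) (units_of S)"
proof -
  have "f u \<in> Units S" if u: "u \<in> Units R" for u
  proof -
    obtain v where v: "v \<in> carrier R" "v \<otimes>\<^bsub>R\<^esub> u = \<one>\<^bsub>R\<^esub>" "u \<otimes>\<^bsub>R\<^esub> v = \<one>\<^bsub>R\<^esub>" "u \<in> carrier R"
      using u unfolding Units_def by blast
    then have "f v \<otimes>\<^bsub>S\<^esub> f u = \<one>\<^bsub>S\<^esub>" "f u \<otimes>\<^bsub>S\<^esub> f v = \<one>\<^bsub>S\<^esub>"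
      using ring_hom_mult[OF assms(3)] ring_hom_one[OF assms(3)] by metis+
    with v show ?thesis
      using ring_hom_closed[OF assms(3)] unfolding Units_def by blast
  qed
  then show ?thesis
    by (intro homI)
      (auto simp: units_of_carrier units_of_mult Units_def ring_hom_mult[OF assms(3)])
qed

context finite_group_algebra
begin

lemma single_minus: "a \<in> carrier F \<Longrightarrow> \<delta> (\<ominus>\<^bsub>F\<^esub> a) g = \<ominus>\<^bsub>FG\<^esub> (\<delta> a g)"
  by (rule FG.minus_equality[symmetric]) (simp_all add: F.l_neg single_zero flip: single_add)

lemma char3_group_algebra:
  assumes "\<one>\<^bsub>F\<^esub> \<oplus>\<^bsub>F\<^esub> \<one>\<^bsub>F\<^esub> \<oplus>\<^bsub>F\<^esub> \<one>\<^bsub>F\<^esub> = \<zero>\<^bsub>F\<^esub>"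
  shows "char3_ring FG"
proof
  show "\<one>\<^bsub>FG\<^esub> \<oplus>\<^bsub>FG\<^esub> \<one>\<^bsub>FG\<^esub> \<oplus>\<^bsub>FG\<^esub> \<one>\<^bsub>FG\<^esub> = \<zero>\<^bsub>FG\<^esub>"
    using assms by (simp add: one_group_algebra single_zero flip: single_add)
qed

lemma units_single:
  assumes "g \<in> carrier G"
  shows "\<delta> \<one>\<^bsub>F\<^esub> g \<in> Units FG"
proof -
  have "\<delta> \<one>\<^bsub>F\<^esub> (inv\<^bsub>G\<^esub> g) \<otimes>\<^bsub>FG\<^esub> \<delta> \<one>\<^bsub>F\<^esub> g = \<one>\<^bsub>FG\<^esub>" "\<delta> \<one>\<^bsub>F\<^esub> g \<otimes>\<^bsub>FG\<^esub> \<delta> \<one>\<^bsub>F\<^esub> (inv\<^bsub>G\<^esub> g) = \<one>\<^bsub>FG\<^esub>"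
    using assms by (simp_all add: single_mult one_group_algebra)
  then show ?thesis by (auto simp: Units_def)
qed

end

text \<open>Each g factors uniquely as a kernel element times \<sigma>(\<pi>(g)).\<close>

lemma (in group) card_split_extension:
  assumes "group H" and \<pi>: "\<pi> \<in> hom G H" and \<sigma>: "\<sigma> \<in> hom H G"
    and \<pi>\<sigma>: "\<And>h. h \<in> carrier H \<Longrightarrow> \<pi> (\<sigma> h) = h"
  shows "card (carrier G) = card (kernel G H \<pi>) * card (carrier H)"
proof -
  interpret \<pi>: group_hom G H \<pi>
    using assms by (simp add: group_hom_def group_hom_axioms_def is_group)
  interpret \<sigma>: group_hom H G \<sigma>
    using assms by (simp add: group_hom_def group_hom_axioms_def is_group)
  have "bij_betw (\<lambda>(u, h). u \<otimes> \<sigma> h) (kernel G H \<pi> \<times> carrier H) (carrier G)"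
    by (rule bij_betw_byWitness[where f' = "\<lambda>g. (g \<otimes> inv (\<sigma> (\<pi> g)), \<pi> g)"])
      (auto simp: kernel_def \<pi>\<sigma> m_assoc)
  then show ?thesis
    by (metis bij_betw_same_card card_cartesian_product)
qed

text \<open>The theorem for any split extension G of an abelian group H by a group of order 3
  generated by \<open>x\<close>. The predicate \<open>E\<close> encodes a sign character of H: lifts
  of even elements centralise \<open>x\<close>, lifts of odd ones invert it. The odd element
  \<open>y\<close> gives the unit that balances the eigenspaces of the involution, and
  \<open>m\<close> is fixed by |FH| = 3^(2m).\<close>

lemma units_group_algebra_C3_extension:
  fixes F (structure) and G (structure) and H :: "('h, 'l) monoid_scheme"
  assumes "finite_group_algebra F G" "finite_group_algebra F H" and commH: "comm_group H"
    and three: "\<one> \<oplus> \<one> \<oplus> \<one> = \<zero>" and card_F: "card (carrier F) = 3 ^ k"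
    and finF: "finite (carrier F)"
    and \<pi>: "\<pi> \<in> hom G H" and \<sigma>: "\<sigma> \<in> hom H G"
    and \<pi>\<sigma>: "\<And>h. h \<in> carrier H \<Longrightarrow> \<pi> (\<sigma> h) = h"
    and ker: "kernel G H \<pi> = {\<one>\<^bsub>G\<^esub>, x, x \<otimes>\<^bsub>G\<^esub> x}"
    and x: "x \<noteq> \<one>\<^bsub>G\<^esub>" "x \<otimes>\<^bsub>G\<^esub> (x \<otimes>\<^bsub>G\<^esub> x) = \<one>\<^bsub>G\<^esub>"
    and E_mult: "\<And>h h'. h \<in> carrier H \<Longrightarrow> h' \<in> carrier H \<Longrightarrow> E (h \<otimes>\<^bsub>H\<^esub> h') \<longleftrightarrow> E h = E h'"
    and conj_even: "\<And>h. h \<in> carrier H \<Longrightarrow> E h \<Longrightarrow> \<sigma> h \<otimes>\<^bsub>G\<^esub> x = x \<otimes>\<^bsub>G\<^esub> \<sigma> h"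
    and conj_odd: "\<And>h. h \<in> carrier H \<Longrightarrow> \<not> E h \<Longrightarrow> \<sigma> h \<otimes>\<^bsub>G\<^esub> x = x \<otimes>\<^bsub>G\<^esub> (x \<otimes>\<^bsub>G\<^esub> \<sigma> h)"
    and y: "y \<in> carrier H" "\<not> E y"
    and m: "k * card (carrier H) = 2 * m"
  shows "\<exists>\<phi> \<psi>. is_action (cyclic_power 3 m) (cyclic_power 3 (3 * m)) \<phi> \<and>
    is_action (units_of (group_algebra F H))
      (semidirect_product (cyclic_power 3 (3 * m)) (cyclic_power 3 m) \<phi>) \<psi> \<and>
    units_of (group_algebra F G) \<cong>
      semidirect_product (semidirect_product (cyclic_power 3 (3 * m)) (cyclic_power 3 m) \<phi>)
        (units_of (group_algebra F H)) \<psi>"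
proof -
  interpret G: finite_group_algebra F G by fact
  interpret H: finite_group_algebra F H by fact
  interpret A: char3_ring G.FG by (rule G.char3_group_algebra[OF three])
  interpret FH: cring H.FG by (rule H.cring_group_algebra[OF commH])
  interpret FH: char3_ring H.FG by (rule H.char3_group_algebra[OF three])
  interpret \<pi>: group_hom G H \<pi>
    using \<pi> by (simp add: group_hom_def group_hom_axioms_def G.G.is_group H.G.is_group)
  interpret \<sigma>: group_hom H G \<sigma>
    using \<sigma> by (simp add: group_hom_def group_hom_axioms_def G.G.is_group H.G.is_group)
  have xG: "x \<in> carrier G" and \<pi>x: "\<pi> x = \<one>\<^bsub>H\<^esub>"
    using ker by (auto simp: kernel_def)
  have xxx: "x \<otimes>\<^bsub>G\<^esub> (x \<otimes>\<^bsub>G\<^esub> (x \<otimes>\<^bsub>G\<^esub> g)) = g" if "g \<in> carrier G" for g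
    using x(2) xG that by (metis G.G.m_assoc G.G.m_closed G.G.l_one)
  \<comment> \<open>The sign character; twisting the identity of H by it gives the involution \<tau>
    that negates odd group elements.\<close>
  define \<chi> where "\<chi> h = (if E h then \<one> else \<ominus> \<one>)" for h
  define P where "P = twisted_pushforward F G H (\<lambda>_. \<one>) \<pi>"
  define s where "s = twisted_pushforward F H G (\<lambda>_. \<one>) \<sigma>"
  define \<tau> where "\<tau> = twisted_pushforward F H H \<chi> (\<lambda>h. h)"
  have P: "P \<in> ring_hom G.FG H.FG" and P_single: "\<And>a g. a \<in> carrier F \<Longrightarrow> g \<in> carrier G \<Longrightarrow>
      P (G.\<delta> a g) = H.\<delta> a (\<pi> g)"
    using G.twisted_pushforward_ring_hom[OF H.finite_group_algebra_axioms \<pi>, of "\<lambda>_. \<one>"]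
    by (auto simp: P_def)
  have s: "s \<in> ring_hom H.FG G.FG" and s_single: "\<And>a h. a \<in> carrier F \<Longrightarrow> h \<in> carrier H \<Longrightarrow>
      s (H.\<delta> a h) = G.\<delta> a (\<sigma> h)"
    using H.twisted_pushforward_ring_hom[OF G.finite_group_algebra_axioms \<sigma>, of "\<lambda>_. \<one>"]
    by (auto simp: s_def)
  \<comment> \<open>With both arguments the identity, \<open>E_mult\<close> has the true right-hand
    side E(1) = E(1).\<close>
  have "E \<one>\<^bsub>H\<^esub>" using E_mult[of "\<one>\<^bsub>H\<^esub>" "\<one>\<^bsub>H\<^esub>"] by simp
  then have \<tau>: "\<tau> \<in> ring_hom H.FG H.FG" and \<tau>_single: "\<And>a h. a \<in> carrier F \<Longrightarrow> h \<in> carrier H \<Longrightarrow>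
      \<tau> (H.\<delta> a h) = H.\<delta> (\<chi> h \<otimes> a) h"
    using H.twisted_pushforward_ring_hom[OF H.finite_group_algebra_axioms, of "\<lambda>h. h" \<chi>]
    by (auto simp: \<tau>_def \<chi>_def E_mult hom_def G.F.l_minus G.F.r_minus)
  interpret P: ring_hom_ring G.FG H.FG P
    using P by (intro ring_hom_ringI2 H.FG.ring_axioms G.FG.ring_axioms)
  interpret s: ring_hom_ring H.FG G.FG s
    using s by (intro ring_hom_ringI2 H.FG.ring_axioms G.FG.ring_axioms)
  interpret \<tau>: ring_hom_ring H.FG H.FG \<tau>
    using \<tau> by (intro ring_hom_ringI2 H.FG.ring_axioms)
  have Ps: "P (s b) = b" if "b \<in> carrier H.FG" for b
    using that by (induction rule: H.group_algebra_induct) (simp_all add: s_single P_single \<pi>\<sigma>)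
  have \<tau>\<tau>: "\<tau> (\<tau> b) = b" if "b \<in> carrier H.FG" for b
    using that by (induction rule: H.group_algebra_induct)
      (simp_all add: \<tau>_single \<chi>_def G.F.l_minus)
  interpret B: char3_involution H.FG \<tau>
    by unfold_locales (simp_all add: \<tau> \<tau>\<tau>)

  define u1 u2 where "u1 = G.\<delta> \<one> x" and "u2 = G.\<delta> \<one> (x \<otimes>\<^bsub>G\<^esub> x)"
  have u1 [simp]: "u1 \<in> carrier G.FG" "u2 \<in> carrier G.FG"
    "u1 \<otimes>\<^bsub>G.FG\<^esub> u1 = u2" "u1 \<otimes>\<^bsub>G.FG\<^esub> u2 = \<one>\<^bsub>G.FG\<^esub>"
    "u2 \<otimes>\<^bsub>G.FG\<^esub> u1 = \<one>\<^bsub>G.FG\<^esub>" "u2 \<otimes>\<^bsub>G.FG\<^esub> u2 = u1"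
    using xG x(2) xxx by (simp_all add: u1_def u2_def G.single_mult one_group_algebra G.G.m_assoc)
  define t where "t = u1 \<ominus>\<^bsub>G.FG\<^esub> u2"
  note char3 = G.FG.l_distr G.FG.r_distr A.neg_eq_double a_minus_def G.FG.a_ac
  have t: "t \<in> carrier G.FG" by (simp add: t_def)
  \<comment> \<open>The cross terms contribute -2 = 1 times the identity.\<close>
  have tt: "t \<otimes>\<^bsub>G.FG\<^esub> t = \<one>\<^bsub>G.FG\<^esub> \<oplus>\<^bsub>G.FG\<^esub> u1 \<oplus>\<^bsub>G.FG\<^esub> u2"
    by (simp add: t_def char3)
  \<comment> \<open>Multiplying 1 + x + x^2 by x or by x^2 leaves it unchanged, so their difference
    t annihilates it.\<close>
  have ttt: "t \<otimes>\<^bsub>G.FG\<^esub> (t \<otimes>\<^bsub>G.FG\<^esub> t) = \<zero>\<^bsub>G.FG\<^esub>"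
    unfolding tt by (simp add: t_def char3)
  \<comment> \<open>Inverting the definition of t: x and x^2 are polynomials in t, which is why the
    powers of t span over the image of \<open>s\<close>.\<close>
  have u_eq: "u1 = \<one>\<^bsub>G.FG\<^esub> \<ominus>\<^bsub>G.FG\<^esub> t \<ominus>\<^bsub>G.FG\<^esub> t \<otimes>\<^bsub>G.FG\<^esub> t"
    "u2 = \<one>\<^bsub>G.FG\<^esub> \<oplus>\<^bsub>G.FG\<^esub> t \<ominus>\<^bsub>G.FG\<^esub> t \<otimes>\<^bsub>G.FG\<^esub> t"
    unfolding tt by (simp_all add: t_def char3)
  have Pt: "P t = \<zero>\<^bsub>H.FG\<^esub>"
    using xG by (simp add: t_def a_minus_def u1_def u2_def P_single \<pi>x H.FG.r_neg)
  have st: "s b \<otimes>\<^bsub>G.FG\<^esub> t = t \<otimes>\<^bsub>G.FG\<^esub> s (\<tau> b)" if "b \<in> carrier H.FG" for b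
    using that
  proof (induction rule: H.group_algebra_induct)
    case (single a h)
    show ?case
    proof (cases "E h")
      case True
      have "\<sigma> h \<otimes>\<^bsub>G\<^esub> (x \<otimes>\<^bsub>G\<^esub> x) = x \<otimes>\<^bsub>G\<^esub> (x \<otimes>\<^bsub>G\<^esub> \<sigma> h)"
        using conj_even[OF single(2) True] xG single by (metis G.G.m_assoc \<sigma>.hom_closed)
      then show ?thesis
        using single True xG conj_even
        by (simp add: t_def u1_def u2_def s_single \<tau>_single \<chi>_def a_minus_def
            G.FG.l_distr G.FG.r_distr
            G.FG.l_minus G.FG.r_minus G.single_mult G.G.m_assoc)
    next
      case False
      \<comment> \<open>An odd element also turns x^2 into x when it passes, so it sends t to -t;
        the sign is absorbed by \<tau>.\<close>
      have "\<sigma> h \<otimes>\<^bsub>G\<^esub> (x \<otimes>\<^bsub>G\<^esub> x) = x \<otimes>\<^bsub>G\<^esub> (x \<otimes>\<^bsub>G\<^esub> (\<sigma> h \<otimes>\<^bsub>G\<^esub> x))"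
        using conj_odd[OF single(2) False] xG single
        by (metis G.G.m_assoc G.G.m_closed \<sigma>.hom_closed)
      also have "\<dots> = x \<otimes>\<^bsub>G\<^esub> \<sigma> h"
        using conj_odd[OF single(2) False] xG single by (simp add: xxx)
      finally show ?thesis
        using single False xG conj_odd
        by (simp add: t_def u1_def u2_def s_single \<tau>_single \<chi>_def a_minus_def
            G.FG.l_distr G.FG.r_distr
            G.FG.l_minus G.FG.r_minus G.single_mult G.G.m_assoc G.F.l_minus G.single_minus
            G.FG.minus_add G.FG.minus_minus G.FG.a_comm)
    qed
  qed (use t in \<open>simp_all add: G.FG.l_distr G.FG.r_distr\<close>)
  have gen: "\<exists>a\<in>carrier H.FG. \<exists>b\<in>carrier H.FG. \<exists>c\<in>carrier H.FG.
      f = s a \<oplus>\<^bsub>G.FG\<^esub> t \<otimes>\<^bsub>G.FG\<^esub> s b \<oplus>\<^bsub>G.FG\<^esub> t \<otimes>\<^bsub>G.FG\<^esub> (t \<otimes>\<^bsub>G.FG\<^esub> s c)"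
    if "f \<in> carrier G.FG" for f
    using that
  proof (induction rule: G.group_algebra_induct)
    case zero
    show ?case
      by (rule bexI[of _ "\<zero>\<^bsub>H.FG\<^esub>"])+ (use t in simp_all)
  next
    case (add f f')
    then obtain a b c a' b' c' where abc: "a \<in> carrier H.FG" "b \<in> carrier H.FG" "c \<in> carrier H.FG"
        "f = s a \<oplus>\<^bsub>G.FG\<^esub> t \<otimes>\<^bsub>G.FG\<^esub> s b \<oplus>\<^bsub>G.FG\<^esub> t \<otimes>\<^bsub>G.FG\<^esub> (t \<otimes>\<^bsub>G.FG\<^esub> s c)"
        "a' \<in> carrier H.FG" "b' \<in> carrier H.FG" "c' \<in> carrier H.FG"
        "f' = s a' \<oplus>\<^bsub>G.FG\<^esub> t \<otimes>\<^bsub>G.FG\<^esub> s b' \<oplus>\<^bsub>G.FG\<^esub> t \<otimes>\<^bsub>G.FG\<^esub> (t \<otimes>\<^bsub>G.FG\<^esub> s c')"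
      by blast
    show ?case
      by (rule bexI[of _ "a \<oplus>\<^bsub>H.FG\<^esub> a'"], rule bexI[of _ "b \<oplus>\<^bsub>H.FG\<^esub> b'"],
          rule bexI[of _ "c \<oplus>\<^bsub>H.FG\<^esub> c'"])
        (use abc t in \<open>simp_all add: G.FG.r_distr G.FG.a_ac\<close>)
  next
    case (single a g)
    define b where "b = H.\<delta> a (\<pi> g)"
    have b: "b \<in> carrier H.FG" using single by (simp add: b_def)
    \<comment> \<open>The quotient of \<open>g\<close> by the lift of its image is 1, x or x^2, so
      the monomial at \<open>g\<close> is \<open>s b\<close> multiplied by 1, \<open>u1\<close> or
      \<open>u2\<close>; \<open>u_eq\<close> then supplies the coefficients.\<close>
    have "g \<otimes>\<^bsub>G\<^esub> inv\<^bsub>G\<^esub> (\<sigma> (\<pi> g)) \<in> kernel G H \<pi>"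
      using single by (simp add: kernel_def \<pi>\<sigma>)
    then have "g = \<sigma> (\<pi> g) \<or> g = x \<otimes>\<^bsub>G\<^esub> \<sigma> (\<pi> g) \<or> g = x \<otimes>\<^bsub>G\<^esub> x \<otimes>\<^bsub>G\<^esub> \<sigma> (\<pi> g)"
      unfolding ker using single xG
      by (metis G.G.inv_closed G.G.inv_solve_right' G.G.l_one G.G.m_closed \<pi>.hom_closed
          \<sigma>.hom_closed empty_iff insert_iff G.G.one_closed)
    moreover have "G.\<delta> a (\<sigma> (\<pi> g)) = s b" "G.\<delta> a (x \<otimes>\<^bsub>G\<^esub> \<sigma> (\<pi> g)) = u1 \<otimes>\<^bsub>G.FG\<^esub> s b"
      "G.\<delta> a (x \<otimes>\<^bsub>G\<^esub> x \<otimes>\<^bsub>G\<^esub> \<sigma> (\<pi> g)) = u2 \<otimes>\<^bsub>G.FG\<^esub> s b"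
      using single xG by (simp_all add: b_def s_single u1_def u2_def G.single_mult)
    ultimately consider "G.\<delta> a g = s b" | "G.\<delta> a g = u1 \<otimes>\<^bsub>G.FG\<^esub> s b" | "G.\<delta> a g = u2 \<otimes>\<^bsub>G.FG\<^esub> s b"
      by metis
    then show ?case
    proof cases
      case 1
      show ?thesis
        by (rule bexI[of _ b], rule bexI[of _ "\<zero>\<^bsub>H.FG\<^esub>"], rule bexI[of _ "\<zero>\<^bsub>H.FG\<^esub>"])
          (use 1 b t in simp_all)
    next
      case 2
      show ?thesis
        by (rule bexI[of _ b], rule bexI[of _ "\<ominus>\<^bsub>H.FG\<^esub> b"], rule bexI[of _ "\<ominus>\<^bsub>H.FG\<^esub> b"])
          (use 2 b t u_eq(1) in
            \<open>simp_all add: G.FG.l_distr a_minus_def G.FG.l_minus G.FG.r_minus G.FG.m_assoc\<close>)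
    next
      case 3
      show ?thesis
        by (rule bexI[of _ b], rule bexI[of _ b], rule bexI[of _ "\<ominus>\<^bsub>H.FG\<^esub> b"])
          (use 3 b t u_eq(2) in
            \<open>simp_all add: G.FG.l_distr a_minus_def G.FG.l_minus G.FG.r_minus G.FG.m_assoc\<close>)
    qed
  qed
  have "x \<otimes>\<^bsub>G\<^esub> x \<noteq> \<one>\<^bsub>G\<^esub>" "x \<otimes>\<^bsub>G\<^esub> x \<noteq> x"
    using x xG by auto
  then have "card (kernel G H \<pi>) = 3"
    using x(1) by (simp add: ker)
  then have cardG: "card (carrier G) = 3 * card (carrier H)"
    using G.G.card_split_extension[OF H.G.is_group \<pi> \<sigma> \<pi>\<sigma>] by simp
  have card: "card (carrier G.FG) = card (carrier H.FG) ^ 3"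
    by (simp add: G.card_group_algebra H.card_group_algebra cardG mult.commute flip: power_mult)
  have card_FH: "card (carrier H.FG) = 3 ^ (2 * m)"
    by (simp add: H.card_group_algebra card_F flip: power_mult m)
  define e where "e = (\<lambda>(b, c). \<one>\<^bsub>G.FG\<^esub> \<oplus>\<^bsub>G.FG\<^esub> t \<otimes>\<^bsub>G.FG\<^esub> s b \<oplus>\<^bsub>G.FG\<^esub> t \<otimes>\<^bsub>G.FG\<^esub> (t \<otimes>\<^bsub>G.FG\<^esub> s c))"
  note e = twisted_square_embedding[OF G.FG.ring_axioms B.char3_involution_axioms s P Ps t
      ttt Pt st gen
      H.finite_group_algebra[OF finF] card, folded e_def]
  have "\<tau> (H.\<delta> \<one> y) = \<ominus>\<^bsub>H.FG\<^esub> (H.\<delta> \<one> y)"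
    using y by (simp add: \<tau>_single \<chi>_def H.single_minus)
  from B.twisted_square_iso_semidirect_product[OF H.units_single[OF y(1)] this
      H.finite_group_algebra[OF finF] card_FH]
  obtain \<phi> where \<phi>: "is_action (cyclic_power 3 m) (cyclic_power 3 (3 * m)) \<phi>"
    and iso: "B.V \<cong> semidirect_product (cyclic_power 3 (3 * m)) (cyclic_power 3 m) \<phi>"
    (is "_ \<cong> ?S") by blast
  have S: "group ?S"
    by (rule group_semidirect_product[OF _ _ \<phi>]) simp_all
  \<comment> \<open>The reversed isomorphism, followed by \<open>e\<close>, embeds the semidirect
    product itself as the kernel of \<open>P\<close> on units.\<close>
  from group.iso_sym[OF B.group_V iso] obtain \<theta> where \<theta>: "\<theta> \<in> iso ?S B.V"
    by (auto simp: is_iso_def)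
  then have \<theta>_image: "\<theta> ` carrier ?S = carrier B.V"
    by (auto simp: iso_def bij_betw_def)
  have "\<exists>\<psi>. is_action (units_of H.FG) ?S \<psi> \<and>
      units_of G.FG \<cong> semidirect_product ?S (units_of H.FG) \<psi>"
  proof (rule split_extension_iso_semidirect_product[where i = "e \<circ> \<theta>" and p = P and s = s])
    show "e \<circ> \<theta> \<in> hom ?S (units_of G.FG)"
      using \<theta> e(1) by (auto simp: iso_def intro: hom_compose)
    show "inj_on (e \<circ> \<theta>) (carrier ?S)"
      using \<theta> e(2) by (auto simp: iso_def bij_betw_def intro: comp_inj_on)
    show "(e \<circ> \<theta>) ` carrier ?S = kernel (units_of G.FG) (units_of H.FG) P"
      unfolding image_comp [symmetric] \<theta>_image by (rule e(3))
  qed (auto simp: S G.FG.units_group H.FG.units_group ring_hom_units P s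
      G.FG.ring_axioms H.FG.ring_axioms
      Ps units_of_carrier)
  with \<phi> show ?thesis by blast
qed

section \<open>Evaluating words, and the structure of the dicyclic group\<close>

section \<open>Presented groups and \<open>Q\<^sub>1\<^sub>2\<close>\<close>

definition word_eval :: "('k, 'm) monoid_scheme \<Rightarrow> ('g \<Rightarrow> 'k) \<Rightarrow> 'g word \<Rightarrow> 'k" where
  "word_eval K f w = foldr (\<lambda>(g, b) a. (if b then f g else inv\<^bsub>K\<^esub> f g) \<otimes>\<^bsub>K\<^esub> a) w \<one>\<^bsub>K\<^esub>"

context group
begin

lemma word_eval_Nil [simp]: "word_eval G f [] = \<one>"
  by (simp add: word_eval_def)

lemma word_eval_Cons [simp]:
  "word_eval G f ((g, b) # w) = (if b then f g else inv f g) \<otimes> word_eval G f w"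
  by (simp add: word_eval_def)

lemma word_eval_closed [simp]: "range f \<subseteq> carrier G \<Longrightarrow> word_eval G f w \<in> carrier G"
  by (induction w) (auto simp: image_subset_iff)

lemma word_eval_append:
  "range f \<subseteq> carrier G \<Longrightarrow> word_eval G f (u @ v) = word_eval G f u \<otimes> word_eval G f v"
  by (induction u) (auto simp: image_subset_iff m_assoc)

lemma word_eval_word_eq:
  assumes "word_eq R u v" and f: "range f \<subseteq> carrier G"
    and "\<And>u v. (u, v) \<in> R \<Longrightarrow> word_eval G f u = word_eval G f v"
  shows "word_eval G f u = word_eval G f v"
  using assms(1)
proof induction
  case (cancel g b)
  then show ?case using f by (simp add: image_subset_iff)
qed (use assms in \<open>auto simp: word_eval_append\<close>)

text \<open>The universal property of a presentation: evaluation of words respects every generating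
  rule of \<open>word_eq\<close>, so it descends to classes.\<close>

lemma presented_group_hom:
  assumes f: "range f \<subseteq> carrier G"
    and R: "\<And>u v. (u, v) \<in> R \<Longrightarrow> word_eval G f u = word_eval G f v"
  obtains h where "h \<in> hom (presented_group R) G" "\<And>w. h (word_class R w) = word_eval G f w"
proof
  \<comment> \<open>A representative is chosen arbitrarily; \<open>word_eval_word_eq\<close> shows
    that the value does not depend on it.\<close>
  define h where "h A = word_eval G f (SOME w. w \<in> A)" for A
  show h: "h (word_class R w) = word_eval G f w" for w
  proof -
    have "word_eq R w (SOME v. v \<in> word_class R w)"
      using someI[of "\<lambda>v. v \<in> word_class R w" w] by (simp add: word_class_def word_eq.refl)
    then show ?thesis
      unfolding h_def by (rule word_eval_word_eq[OF _ f R, symmetric])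
  qed
  show "h \<in> hom (presented_group R) G"
    by (rule homI) (auto simp: h f word_eval_append)
qed

end

text \<open>Odd elements of the cyclic group of order 4 act by inversion on the one of order 3. The
  resulting semidirect product is a concrete model of \<open>Q12\<close>.\<close>

definition neg_action :: "int \<Rightarrow> int \<Rightarrow> int" where
  "neg_action i = (\<lambda>a\<in>{0..<3}. if even i then a else - a mod 3)"

lemma is_action_neg_action: "is_action (cyclic_gp 4) (cyclic_gp 3) neg_action"
proof -
  have range: "neg_action i a \<in> {0..<3}" if "a \<in> {0..<3}" for a i
    using that by (simp add: neg_action_def)
  have invol: "neg_action i (neg_action i a) = a" if "a \<in> {0..<3}" for a i
    using that range[OF that, of i] by (auto simp: neg_action_def mod_minus_eq)
  have "bij_betw (neg_action i) {0..<3} {0..<3}" for i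
    by (rule bij_betw_byWitness[where f' = "neg_action i"]) (use invol range in auto)
  moreover have "neg_action i \<in> hom (cyclic_gp 3) (cyclic_gp 3)" for i
  proof (rule homI)
    fix a b assume "a \<in> carrier (cyclic_gp 3)" "b \<in> carrier (cyclic_gp 3)"
    then show "neg_action i (a \<otimes>\<^bsub>cyclic_gp 3\<^esub> b) = neg_action i a \<otimes>\<^bsub>cyclic_gp 3\<^esub> neg_action i b"
      by (simp add: carrier_integer_mod_group neg_action_def mod_simps)
  qed (use range in \<open>simp add: carrier_integer_mod_group\<close>)
  moreover have "neg_action i \<in> extensional {0..<3}" for i
    by (simp add: neg_action_def)
  moreover have "neg_action ((i + j) mod 4) = compose {0..<3} (neg_action i) (neg_action j)" for i j
  proof -
    \<comment> \<open>Reduction modulo 4 preserves parity, so the action is compatible with addition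
      in the group of order 4.\<close>
    have "even ((i + j) mod 4) \<longleftrightarrow> even (i + j)" by presburger
    then show ?thesis
      using invol by (auto simp: compose_def neg_action_def fun_eq_iff mod_minus_eq)
  qed
  ultimately show ?thesis
    unfolding is_action_iff by (simp add: auto_def Bij_def carrier_integer_mod_group)
qed

abbreviation Q12_x :: "q12_gen word set" where
  "Q12_x \<equiv> word_class Q12_relations [(Gen_x, True)]"

abbreviation Q12_y :: "q12_gen word set" where
  "Q12_y \<equiv> word_class Q12_relations [(Gen_y, True)]"

lemma group_Q12: "group Q12"
  by (simp add: Q12_def group_presented_group)

interpretation Q12: group Q12
  by (rule group_Q12)

lemma Q12_gens_closed [simp]: "Q12_x \<in> carrier Q12" "Q12_y \<in> carrier Q12"
  by (simp_all add: Q12_def)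

lemma Q12_relations_hold:
  "Q12_x \<otimes>\<^bsub>Q12\<^esub> (Q12_x \<otimes>\<^bsub>Q12\<^esub> Q12_x) = \<one>\<^bsub>Q12\<^esub>"
  "Q12_y \<otimes>\<^bsub>Q12\<^esub> (Q12_y \<otimes>\<^bsub>Q12\<^esub> (Q12_y \<otimes>\<^bsub>Q12\<^esub> Q12_y)) = \<one>\<^bsub>Q12\<^esub>"
  "Q12_x \<otimes>\<^bsub>Q12\<^esub> Q12_y = Q12_y \<otimes>\<^bsub>Q12\<^esub> (Q12_x \<otimes>\<^bsub>Q12\<^esub> Q12_x)"
  by (auto simp: Q12_def word_class_eq_iff Q12_relations_def Let_def intro!: word_eq.relation)

lemma Q12_x_cubed_mult:
  assumes "z \<in> carrier Q12"
  shows "Q12_x \<otimes>\<^bsub>Q12\<^esub> (Q12_x \<otimes>\<^bsub>Q12\<^esub> (Q12_x \<otimes>\<^bsub>Q12\<^esub> z)) = z"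
  using assms Q12_relations_hold(1)
  by (metis Q12.l_one Q12.m_assoc Q12.m_closed Q12_gens_closed(1))

text \<open>From x y = y x^2 one gets x^2 y = x y x^2 = y x^4 = y x. This orientation moves y to the
  right, as the normal form x^a y^i requires.\<close>

lemma Q12_y_x: "Q12_y \<otimes>\<^bsub>Q12\<^esub> Q12_x = Q12_x \<otimes>\<^bsub>Q12\<^esub> (Q12_x \<otimes>\<^bsub>Q12\<^esub> Q12_y)"
proof -
  have "Q12_x \<otimes>\<^bsub>Q12\<^esub> (Q12_x \<otimes>\<^bsub>Q12\<^esub> Q12_y) = Q12_x \<otimes>\<^bsub>Q12\<^esub> (Q12_y \<otimes>\<^bsub>Q12\<^esub> (Q12_x \<otimes>\<^bsub>Q12\<^esub> Q12_x))"
    by (simp only: Q12_relations_hold(3))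
  also have "\<dots> = (Q12_x \<otimes>\<^bsub>Q12\<^esub> Q12_y) \<otimes>\<^bsub>Q12\<^esub> (Q12_x \<otimes>\<^bsub>Q12\<^esub> Q12_x)"
    by (simp add: Q12.m_assoc)
  also have "\<dots> = (Q12_y \<otimes>\<^bsub>Q12\<^esub> (Q12_x \<otimes>\<^bsub>Q12\<^esub> Q12_x)) \<otimes>\<^bsub>Q12\<^esub> (Q12_x \<otimes>\<^bsub>Q12\<^esub> Q12_x)"
    by (simp only: Q12_relations_hold(3))
  also have "\<dots> = Q12_y \<otimes>\<^bsub>Q12\<^esub> (Q12_x \<otimes>\<^bsub>Q12\<^esub> (Q12_x \<otimes>\<^bsub>Q12\<^esub> (Q12_x \<otimes>\<^bsub>Q12\<^esub> Q12_x)))"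
    by (simp add: Q12.m_assoc)
  finally show ?thesis by (simp add: Q12_x_cubed_mult)
qed

lemma Q12_y_x_mult:
  assumes "z \<in> carrier Q12"
  shows "Q12_y \<otimes>\<^bsub>Q12\<^esub> (Q12_x \<otimes>\<^bsub>Q12\<^esub> z) = Q12_x \<otimes>\<^bsub>Q12\<^esub> (Q12_x \<otimes>\<^bsub>Q12\<^esub> (Q12_y \<otimes>\<^bsub>Q12\<^esub> z))"
  using assms Q12_y_x by (metis Q12.m_assoc Q12.m_closed Q12_gens_closed)

lemma Q12_y_pow_4: "Q12_y [^]\<^bsub>Q12\<^esub> (4::nat) = \<one>\<^bsub>Q12\<^esub>"
  using Q12_relations_hold(2) by (simp add: eval_nat_numeral Q12.m_assoc)

lemma Q12_y_pow_x:
  assumes "i \<in> {0..<4}"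
  shows "even i \<Longrightarrow> Q12_y [^]\<^bsub>Q12\<^esub> (i::int) \<otimes>\<^bsub>Q12\<^esub> Q12_x = Q12_x \<otimes>\<^bsub>Q12\<^esub> Q12_y [^]\<^bsub>Q12\<^esub> i"
    and "odd i \<Longrightarrow> Q12_y [^]\<^bsub>Q12\<^esub> i \<otimes>\<^bsub>Q12\<^esub> Q12_x =
      Q12_x \<otimes>\<^bsub>Q12\<^esub> (Q12_x \<otimes>\<^bsub>Q12\<^esub> Q12_y [^]\<^bsub>Q12\<^esub> i)"
proof -
  have "i = int 0 \<or> i = int 1 \<or> i = int 2 \<or> i = int 3"
    using assms by auto
  then show "even i \<Longrightarrow> Q12_y [^]\<^bsub>Q12\<^esub> i \<otimes>\<^bsub>Q12\<^esub> Q12_x = Q12_x \<otimes>\<^bsub>Q12\<^esub> Q12_y [^]\<^bsub>Q12\<^esub> i"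
    and "odd i \<Longrightarrow> Q12_y [^]\<^bsub>Q12\<^esub> i \<otimes>\<^bsub>Q12\<^esub> Q12_x =
      Q12_x \<otimes>\<^bsub>Q12\<^esub> (Q12_x \<otimes>\<^bsub>Q12\<^esub> Q12_y [^]\<^bsub>Q12\<^esub> i)"
    by (elim disjE; simp only: int_pow_int;
        simp add: eval_nat_numeral Q12.m_assoc Q12_y_x Q12_y_x_mult Q12_x_cubed_mult)+
qed

text \<open>The elements x^a y^i with a < 3 and 0 \<le> i < 4 contain the identity and are stable
  under left multiplication by x and y, hence under their inverses x^2 and y^3. Induction on the
  word covers every class; distinctness of the forms is not claimed here.\<close>

lemma Q12_normal_form:
  assumes "q \<in> carrier Q12"
  shows "\<exists>i\<in>{0..<4::int}. q \<in> {Q12_y [^]\<^bsub>Q12\<^esub> i, Q12_x \<otimes>\<^bsub>Q12\<^esub> Q12_y [^]\<^bsub>Q12\<^esub> i,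
    Q12_x \<otimes>\<^bsub>Q12\<^esub> (Q12_x \<otimes>\<^bsub>Q12\<^esub> Q12_y [^]\<^bsub>Q12\<^esub> i)}" (is "?P q")
proof -
  have step_x: "?P (Q12_x \<otimes>\<^bsub>Q12\<^esub> z)" if "?P z" for z
    using that by (auto simp: Q12_x_cubed_mult)
  have step_y: "?P (Q12_y \<otimes>\<^bsub>Q12\<^esub> z)" if z: "?P z" for z
  proof -
    from z obtain i :: int where i: "z \<in> {Q12_y [^]\<^bsub>Q12\<^esub> i, Q12_x \<otimes>\<^bsub>Q12\<^esub> Q12_y [^]\<^bsub>Q12\<^esub> i,
        Q12_x \<otimes>\<^bsub>Q12\<^esub> (Q12_x \<otimes>\<^bsub>Q12\<^esub> Q12_y [^]\<^bsub>Q12\<^esub> i)}" by auto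
    define j where "j = (1 + i) mod 4"
    have "Q12_y \<otimes>\<^bsub>Q12\<^esub> Q12_y [^]\<^bsub>Q12\<^esub> i = Q12_y [^]\<^bsub>Q12\<^esub> (1 + i)"
      by (simp add: Q12.int_pow_mult)
    also have "\<dots> = Q12_y [^]\<^bsub>Q12\<^esub> j"
      unfolding j_def using Q12.int_pow_mod_exponent[OF _ Q12_y_pow_4] by simp
    finally have step: "Q12_y \<otimes>\<^bsub>Q12\<^esub> Q12_y [^]\<^bsub>Q12\<^esub> i = Q12_y [^]\<^bsub>Q12\<^esub> j" .
    have "Q12_y \<otimes>\<^bsub>Q12\<^esub> z \<in> {Q12_y [^]\<^bsub>Q12\<^esub> j, Q12_x \<otimes>\<^bsub>Q12\<^esub> Q12_y [^]\<^bsub>Q12\<^esub> j,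
        Q12_x \<otimes>\<^bsub>Q12\<^esub> (Q12_x \<otimes>\<^bsub>Q12\<^esub> Q12_y [^]\<^bsub>Q12\<^esub> j)}"
      using i by (elim insertE emptyE) (simp_all add: Q12_y_x_mult Q12_x_cubed_mult step)
    moreover have "j \<in> {0..<4}" by (simp add: j_def)
    ultimately show ?thesis by blast
  qed
  \<comment> \<open>The class of a formal inverse letter undoes the generator; with x^3 = 1 and y^4
    = 1 such letters become positive powers.\<close>
  have cancel: "word_class Q12_relations [(g, False)] \<otimes>\<^bsub>Q12\<^esub>
      (word_class Q12_relations [(g, True)] \<otimes>\<^bsub>Q12\<^esub> z) = z"
    if z: "z \<in> carrier Q12" for g z
  proof -
    obtain u where u: "z = word_class Q12_relations u" using z by (auto simp: Q12_def)
    have "word_eq Q12_relations ([(g, False), (g, \<not> False)] @ u) ([] @ u)"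
      by (intro word_eq.append word_eq.cancel word_eq.refl)
    then show ?thesis by (simp add: u Q12_def word_class_eq_iff)
  qed
  have inv_x: "word_class Q12_relations [(Gen_x, False)] \<otimes>\<^bsub>Q12\<^esub> z = Q12_x \<otimes>\<^bsub>Q12\<^esub> (Q12_x \<otimes>\<^bsub>Q12\<^esub> z)"
    if z: "z \<in> carrier Q12" for z
    using cancel[of "Q12_x \<otimes>\<^bsub>Q12\<^esub> (Q12_x \<otimes>\<^bsub>Q12\<^esub> z)" Gen_x] z by (simp add: Q12_x_cubed_mult)
  have y4: "Q12_y \<otimes>\<^bsub>Q12\<^esub> (Q12_y \<otimes>\<^bsub>Q12\<^esub> (Q12_y \<otimes>\<^bsub>Q12\<^esub> (Q12_y \<otimes>\<^bsub>Q12\<^esub> z))) = z"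
    if z: "z \<in> carrier Q12" for z
  proof -
    have "Q12_y \<otimes>\<^bsub>Q12\<^esub> (Q12_y \<otimes>\<^bsub>Q12\<^esub> (Q12_y \<otimes>\<^bsub>Q12\<^esub> (Q12_y \<otimes>\<^bsub>Q12\<^esub> z))) =
        Q12_y \<otimes>\<^bsub>Q12\<^esub> (Q12_y \<otimes>\<^bsub>Q12\<^esub> (Q12_y \<otimes>\<^bsub>Q12\<^esub> Q12_y)) \<otimes>\<^bsub>Q12\<^esub> z"
      using z by (simp add: Q12.m_assoc)
    then show ?thesis using z by (simp only: Q12_relations_hold(2) Q12.l_one)
  qed
  have inv_y: "word_class Q12_relations [(Gen_y, False)] \<otimes>\<^bsub>Q12\<^esub> z =
      Q12_y \<otimes>\<^bsub>Q12\<^esub> (Q12_y \<otimes>\<^bsub>Q12\<^esub> (Q12_y \<otimes>\<^bsub>Q12\<^esub> z))"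
    if z: "z \<in> carrier Q12" for z
    using cancel[of "Q12_y \<otimes>\<^bsub>Q12\<^esub> (Q12_y \<otimes>\<^bsub>Q12\<^esub> (Q12_y \<otimes>\<^bsub>Q12\<^esub> z))" Gen_y] z by (simp add: y4)
  have "?P (word_class Q12_relations w)" for w
  proof (induction w)
    case Nil
    show ?case
      by (rule bexI[of _ 0]) (simp_all add: Q12_def)
  next
    case (Cons l w)
    have w: "word_class Q12_relations w \<in> carrier Q12" by (simp add: Q12_def)
    have "word_class Q12_relations (l # w) =
        word_class Q12_relations [l] \<otimes>\<^bsub>Q12\<^esub> word_class Q12_relations w"
      by (simp add: Q12_def)
    moreover have "?P (word_class Q12_relations [l] \<otimes>\<^bsub>Q12\<^esub> word_class Q12_relations w)"
    proof -
      obtain g b where l: "l = (g, b)" by (cases l)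
      show ?thesis
        unfolding l using Cons.IH w
        by (cases g; cases b; simp only: inv_x inv_y; intro step_x step_y)
    qed
    ultimately show ?case by simp
  qed
  then show ?thesis
    using assms by (auto simp: Q12_def)
qed

text \<open>Relations alone cannot show that x survives. Mapping to the model does: x goes to a
  nontrivial element, and the second component counts y modulo 4. On a normal form x^a y^i this
  count is i, so its kernel is the set of powers of x.\<close>

lemma Q12_degree:
  obtains d where "d \<in> hom Q12 (cyclic_gp 4)" "d Q12_y = 1" "kernel Q12 (cyclic_gp 4) d =
    {\<one>\<^bsub>Q12\<^esub>, Q12_x, Q12_x \<otimes>\<^bsub>Q12\<^esub> Q12_x}" "Q12_x \<noteq> \<one>\<^bsub>Q12\<^esub>"
proof -
  let ?M = "semidirect_product (cyclic_gp 3) (cyclic_gp 4) neg_action"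
  interpret M: group ?M
    by (rule group_semidirect_product) (simp_all add: is_action_neg_action)
  \<comment> \<open>x goes to the generator of the normal factor, y to that of the acting
    factor.\<close>
  define f where "f = case_q12_gen (1 :: int, 0 :: int) (0, 1)"
  have f: "range f \<subseteq> carrier ?M"
    by (auto simp: f_def semidirect_product_def carrier_integer_mod_group split: q12_gen.splits)
  have rel: "word_eval ?M f u = word_eval ?M f v" if "(u, v) \<in> Q12_relations" for u v
    using that
    by (auto simp: Q12_relations_def Let_def word_eval_def f_def semidirect_product_def neg_action_def)
  obtain h where h: "h \<in> hom Q12 ?M" "\<And>w. h (word_class Q12_relations w) = word_eval ?M f w"
    unfolding Q12_def using M.presented_group_hom[OF f rel] by metis
  have hx: "h Q12_x = (1, 0)" and hy: "h Q12_y = (0, 1)"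
    by (simp_all add: h(2) word_eval_def f_def semidirect_product_def neg_action_def)
  define d where "d = snd \<circ> h"
  have d: "d \<in> hom Q12 (cyclic_gp 4)"
    unfolding d_def
  proof (rule hom_compose[OF h(1)])
    show "snd \<in> hom ?M (cyclic_gp 4)"
      by (rule homI) (auto simp: semidirect_product_def)
  qed
  interpret d: group_hom Q12 "cyclic_gp 4" d
    using d by (simp add: group_hom_def group_hom_axioms_def Q12.is_group)
  have dx: "d Q12_x = 0" and dy: "d Q12_y = 1"
    by (simp_all add: d_def hx hy)
  have d_pow: "d (Q12_y [^]\<^bsub>Q12\<^esub> i) = i" if "i \<in> {0..<4}" for i :: int
    using that by (simp add: d.hom_int_pow dy int_pow_integer_mod_group)
  have "kernel Q12 (cyclic_gp 4) d = {\<one>\<^bsub>Q12\<^esub>, Q12_x, Q12_x \<otimes>\<^bsub>Q12\<^esub> Q12_x}"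
  proof (intro equalityI subsetI)
    fix q assume q: "q \<in> kernel Q12 (cyclic_gp 4) d"
    then have "q \<in> carrier Q12" "d q = 0" by (auto simp: kernel_def)
    from Q12_normal_form[OF this(1)] obtain i :: int where i: "i \<in> {0..<4}"
      "q \<in> {Q12_y [^]\<^bsub>Q12\<^esub> i, Q12_x \<otimes>\<^bsub>Q12\<^esub> Q12_y [^]\<^bsub>Q12\<^esub> i,
        Q12_x \<otimes>\<^bsub>Q12\<^esub> (Q12_x \<otimes>\<^bsub>Q12\<^esub> Q12_y [^]\<^bsub>Q12\<^esub> i)}" by blast
    then have "d q = i"
      using d_pow[OF i(1)] by (auto simp: dx)
    with \<open>d q = 0\<close> i(2) show "q \<in> {\<one>\<^bsub>Q12\<^esub>, Q12_x, Q12_x \<otimes>\<^bsub>Q12\<^esub> Q12_x}" by auto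
  qed (auto simp: kernel_def dx)
  moreover have "Q12_x \<noteq> \<one>\<^bsub>Q12\<^esub>"
  proof
    assume "Q12_x = \<one>\<^bsub>Q12\<^esub>"
    then have "h Q12_x = word_eval ?M f []"
      using h(2)[of "[]"] by (simp add: Q12_def)
    then show False by (simp add: hx) (simp add: semidirect_product_def)
  qed
  ultimately show thesis using that[OF d dy] by blast
qed

lemma finite_Q12: "finite (carrier Q12)"
proof (rule finite_subset)
  show "carrier Q12 \<subseteq> (\<Union>i\<in>{0..<4::int}. {Q12_y [^]\<^bsub>Q12\<^esub> i, Q12_x \<otimes>\<^bsub>Q12\<^esub> Q12_y [^]\<^bsub>Q12\<^esub> i,
      Q12_x \<otimes>\<^bsub>Q12\<^esub> (Q12_x \<otimes>\<^bsub>Q12\<^esub> Q12_y [^]\<^bsub>Q12\<^esub> i)})"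
    using Q12_normal_form by blast
qed simp

section \<open>Specialisation to the direct product of a cyclic group with
  \<open>Q12\<close>\<close>

theorem theorem2p2:
  fixes F :: "('a, 'm) ring_scheme" and k n :: nat
  assumes "field F" and "finite (carrier F)" and "ring_characteristic F = 3"
    and "card (carrier F) = 3 ^ k" and "n \<ge> 1"
  shows "\<exists>\<phi> \<psi>.
    is_action (cyclic_power 3 (2 * n * k)) (cyclic_power 3 (6 * n * k)) \<phi> \<and>
    is_action (units_of (group_algebra F (cyclic_gp n \<times>\<times> cyclic_gp 4)))
      (semidirect_product (cyclic_power 3 (6 * n * k)) (cyclic_power 3 (2 * n * k)) \<phi>) \<psi> \<and>
    units_of (group_algebra F (cyclic_gp n \<times>\<times> Q12)) \<cong>
      semidirect_product
        (semidirect_product (cyclic_power 3 (6 * n * k)) (cyclic_power 3 (2 * n * k)) \<phi>)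
        (units_of (group_algebra F (cyclic_gp n \<times>\<times> cyclic_gp 4))) \<psi>"
proof -
  interpret F: field F by fact
  let ?H = "cyclic_gp n \<times>\<times> cyclic_gp 4" and ?G = "cyclic_gp n \<times>\<times> Q12"
  interpret Cn: comm_group "cyclic_gp n" by simp
  interpret C4: comm_group "cyclic_gp 4" by simp
  \<comment> \<open>The bound on n matters: \<open>cyclic_gp 0\<close> would be the infinite group
    of integers.\<close>
  have Cn: "carrier (cyclic_gp n) = {0..<int n}"
    using \<open>n \<ge> 1\<close> by (simp add: carrier_integer_mod_group)
  have C4: "carrier (cyclic_gp 4) = {0..<4}"
    by (simp add: carrier_integer_mod_group)
  have "\<one>\<^bsub>F\<^esub> [^]\<^bsub>add_monoid F\<^esub> (3::nat) = \<zero>\<^bsub>F\<^esub>"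
    using F.add.pow_ord_eq_1[of "\<one>\<^bsub>F\<^esub>"] \<open>ring_characteristic F = 3\<close>
    by (metis F.one_closed add_pow_def ring_characteristic_def)
  then have three: "\<one>\<^bsub>F\<^esub> \<oplus>\<^bsub>F\<^esub> \<one>\<^bsub>F\<^esub> \<oplus>\<^bsub>F\<^esub> \<one>\<^bsub>F\<^esub> = \<zero>\<^bsub>F\<^esub>"
    by (simp add: eval_nat_numeral)
  obtain d where d: "d \<in> hom Q12 (cyclic_gp 4)" "d Q12_y = 1"
    "kernel Q12 (cyclic_gp 4) d = {\<one>\<^bsub>Q12\<^esub>, Q12_x, Q12_x \<otimes>\<^bsub>Q12\<^esub> Q12_x}" "Q12_x \<noteq> \<one>\<^bsub>Q12\<^esub>"
    by (rule Q12_degree)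
  interpret d: group_hom Q12 "cyclic_gp 4" d
    using d by (simp add: group_hom_def group_hom_axioms_def Q12.is_group)
  \<comment> \<open>The map collapses x and keeps the cyclic factor; its section
    \<open>\<sigma>\<close> lifts a residue i to y^i, which respects addition modulo 4 because y^4 =
    1.\<close>
  define \<pi> where "\<pi> = (\<lambda>(a :: int, q). (a, d q))"
  define \<sigma> where "\<sigma> = (\<lambda>(a :: int, i :: int). (a, Q12_y [^]\<^bsub>Q12\<^esub> i))"
  \<comment> \<open>The general result is used with m = 2nk, parity of the second coordinate as
    \<open>E\<close>, and (0, 1) as the odd element.\<close>
  have "\<exists>\<phi> \<psi>. is_action (cyclic_power 3 (2 * n * k)) (cyclic_power 3 (3 * (2 * n * k))) \<phi> \<and>
    is_action (units_of (group_algebra F ?H))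
      (semidirect_product (cyclic_power 3 (3 * (2 * n * k))) (cyclic_power 3 (2 * n * k)) \<phi>) \<psi> \<and>
    units_of (group_algebra F ?G) \<cong>
      semidirect_product
        (semidirect_product (cyclic_power 3 (3 * (2 * n * k))) (cyclic_power 3 (2 * n * k)) \<phi>)
        (units_of (group_algebra F ?H)) \<psi>"
  proof (rule units_group_algebra_C3_extension[where \<pi> = \<pi> and \<sigma> = \<sigma> and x = "(0, Q12_x)"
        and E = "\<lambda>(a, i). even i" and y = "(0, 1)" and k = k])
    show "finite_group_algebra F ?G" "finite_group_algebra F ?H"
      by (auto intro!: finite_group_algebra.intro finite_group_algebra_axioms.intro
          DirProd_group F.is_cring simp: Q12.is_group Cn C4 finite_Q12)
    show "comm_group ?H"
      by (rule group.group_comm_groupI[OF DirProd_group]) (auto simp: add.commute)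
    show "\<pi> \<in> hom ?G ?H"
      by (rule homI) (auto simp: \<pi>_def)
    show "\<sigma> \<in> hom ?H ?G"
      by (rule homI)
        (auto simp: \<sigma>_def Q12.int_pow_mult Q12.int_pow_mod_exponent[OF _ Q12_y_pow_4, simplified])
    show "\<pi> (\<sigma> h) = h" if "h \<in> carrier ?H" for h
      using that by (auto simp: \<pi>_def \<sigma>_def d.hom_int_pow d(2) int_pow_integer_mod_group C4)
    have "kernel ?G ?H \<pi> = {0} \<times> kernel Q12 (cyclic_gp 4) d"
      using \<open>n \<ge> 1\<close> by (auto simp: kernel_def \<pi>_def Cn)
    then show "kernel ?G ?H \<pi> = {\<one>\<^bsub>?G\<^esub>, (0, Q12_x), (0, Q12_x) \<otimes>\<^bsub>?G\<^esub> (0, Q12_x)}"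
      by (auto simp: d(3))
    show "(case h \<otimes>\<^bsub>?H\<^esub> h' of (a, i) \<Rightarrow> even i) \<longleftrightarrow>
        (case h of (a, i) \<Rightarrow> even i) = (case h' of (a, i) \<Rightarrow> even i)" for h h' :: "int \<times> int"
    proof -
      have "even ((i + j) mod 4) \<longleftrightarrow> even i = even j" for i j :: int by presburger
      then show ?thesis by (simp add: case_prod_beta mult_DirProd')
    qed
    show "\<sigma> h \<otimes>\<^bsub>?G\<^esub> (0, Q12_x) = (0, Q12_x) \<otimes>\<^bsub>?G\<^esub> \<sigma> h"
      if "h \<in> carrier ?H" "case h of (a, i) \<Rightarrow> even i" for h
      using that by (auto simp: \<sigma>_def Q12_y_pow_x C4)
    show "\<sigma> h \<otimes>\<^bsub>?G\<^esub> (0, Q12_x) = (0, Q12_x) \<otimes>\<^bsub>?G\<^esub> ((0, Q12_x) \<otimes>\<^bsub>?G\<^esub> \<sigma> h)"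
      if "h \<in> carrier ?H" "\<not> (case h of (a, i) \<Rightarrow> even i)" for h
      using that by (auto simp: \<sigma>_def Q12_y_pow_x C4)
    \<comment> \<open>H has 4n elements, so the exponent 4nk of |FH| is twice 2nk.\<close>
    show "k * card (carrier ?H) = 2 * (2 * n * k)"
      by (simp add: Cn C4 card_cartesian_product)
  qed (use assms three d(4) Q12_relations_hold(1) in \<open>auto simp: Cn C4\<close>)
  moreover have "3 * (2 * n * k) = 6 * n * k" by simp
  ultimately show ?thesis by (simp only:)
qed

end
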